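(* Let $p\ge 0$ be an integer, let $f\in\mathcal E_p$ with zeros $-\lambda_m$ ($0\le\lambda_1\le\lambda_2\le\cdots$, counted with multiplicity), and let $0\le a_1\le\cdots\le a_n$ and $0\le b_1\le\cdots\le b_n$ be real numbers. Let $W_f(z)=\prod_{k=1}^n f(z+a_k)\big/\prod_{k=1}^n f(z+b_k)$, and put $$h(s)=\sum_{m\ge 1} e^{-\lambda_m s},\qquad g(s)=\frac1{s^2}\sum_{k=1}^n\left(e^{-sa_k}-e^{-sb_k}\right)\qquad(s>0),$$ $$\rho(t)=\sum_{k=1}^n (t-a_k)\mathbf 1_{[a_k,\infty)}(t)-\sum_{k=1}^n (t-b_k)\mathbf 1_{[b_k,\infty)}(t),\qquad \phi(t)=\sum_{m\ge 1}\rho(t-\lambda_m).$$ Then for all $z$ with $\Re z>0$, $$(-1)^{p-1}\partial_z^p\log W_f(z)=\int_0^\infty e^{-sz}s^{p+1}h(s)g(s)\,ds=\Gamma(p+2)\int_0^\infty\frac{\phi(t)\,dt}{(z+t)^{p+2}}.$$ Moreover, if $b\prec_w a$, then $(-1)^{p-1}\partial_z^p\log W_f(z)$ is a generalised Stieltjes function of order $p+2$.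
   Context: $\mathcal E_p$ denotes the class of entire functions $f$ that are real on the real axis, of genus $p$, have only real and non-positive zeros, and satisfy $f(x)>0$ for $x>0$. The zeros are written $-\lambda_m$, listed with multiplicity, and sums over $m$ run over all zeros. $\log f$ denotes the holomorphic branch on $\mathbb C\setminus(-\infty,0]$ that is real on $(0,\infty)$, and $\log W_f(z)=\sum_{k=1}^n(\log f(z+a_k)-\log f(z+b_k))$. $\partial_z$ is differentiation with respect to $z$, and $\mathbf 1_S$ is the indicator function of $S$. Weak supermajorisation: $b\prec_w a$ means $\sum_{k=1}^m a_k\le\sum_{k=1}^m b_k$ for all $m\in\{1,\ldots,n\}$ (sequences in non-decreasing order). A function $F$ on $(0,\infty)$ is a generalised Stieltjes function of order $\lambda>0$ if $F(x)=\int_0^\infty \frac{d\mu(t)}{(t+x)^\lambda}+c$ for all $x>0$, for some positive (i.e. non-negative) measure $\mu$ on $[0,\infty)$ making the integral converge and some $c\ge 0$. A function of a complex variable is called generalised Stieltjes if its restriction to $(0,\infty)$ is. *)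

theory Defs
  imports "HOL-Complex_Analysis.Complex_Analysis" "HOL-Library.Extended_Nat"
begin

text \<open>
  A finite or infinite sequence \<open>x\<^sub>1, x\<^sub>2, \<dots>\<close> is given by a function on \<^typ>\<open>nat\<close> together with
  its length \<open>N\<close>, an extended natural number; only the values at indices in \<open>indices N\<close> matter.
\<close>

definition indices :: "enat \<Rightarrow> nat set" where
  "indices N = {m. 1 \<le> m \<and> enat m \<le> N}"

text \<open>
  The genus of an entire function is read off its Hadamard factorisation
  \<open>f(z) = z\<^sup>k exp(Q(z)) \<Prod>\<^sub>m E\<^sub>q(z/\<alpha>\<^sub>m)\<close>: it is the maximum of the degree of \<open>Q\<close> and
  the rank, the least \<open>q\<close> for which \<open>\<Sum>\<^sub>m \<bar>\<alpha>\<^sub>m\<bar>\<^bsup>-(q+1)\<^esup>\<close> converges.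
  Multiplicative constants are absorbed in \<open>Q\<close>. The indices of the infinite product start at 0,
  and factors beyond the length \<open>N\<close> of the sequence are 1.
\<close>

definition has_genus :: "(complex \<Rightarrow> complex) \<Rightarrow> nat \<Rightarrow> bool" where
  "has_genus f p \<longleftrightarrow>
     (\<exists>(k::nat) (Q::complex poly) (N::enat) (\<alpha>::nat \<Rightarrow> complex) (q::nat).
        (\<forall>m\<in>indices N. \<alpha> m \<noteq> 0) \<and>
        (\<lambda>m. 1 / norm (\<alpha> m) ^ (q + 1)) summable_on indices N \<and>
        (\<forall>r<q. \<not> (\<lambda>m. 1 / norm (\<alpha> m) ^ (r + 1)) summable_on indices N) \<and>
        (\<forall>z. f z = z ^ k * exp (poly Q z) *
               (\<Prod>m. if Suc m \<in> indices N then weierstrass_factor q (z / \<alpha> (Suc m)) else 1)) \<and>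
        p = max (degree Q) q)"

definition class_E :: "nat \<Rightarrow> (complex \<Rightarrow> complex) set" where
  "class_E p = {f. f holomorphic_on UNIV \<and> (\<forall>x::real. f (of_real x) \<in> \<real>) \<and> has_genus f p \<and>
                   (\<forall>z. f z = 0 \<longrightarrow> z \<in> \<real>\<^sub>\<le>\<^sub>0) \<and> (\<forall>x::real. x > 0 \<longrightarrow> Re (f (of_real x)) > 0)}"

definition lists_zeros :: "(complex \<Rightarrow> complex) \<Rightarrow> enat \<Rightarrow> (nat \<Rightarrow> complex) \<Rightarrow> bool" where
  "lists_zeros f N \<alpha> \<longleftrightarrow>
     (\<forall>w. finite {m\<in>indices N. \<alpha> m = w} \<and>
          int (card {m\<in>indices N. \<alpha> m = w}) = (if f w = 0 then zorder f w else 0))"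

definition is_log_branch :: "(complex \<Rightarrow> complex) \<Rightarrow> (complex \<Rightarrow> complex) \<Rightarrow> bool" where
  "is_log_branch f L \<longleftrightarrow> L holomorphic_on (- \<real>\<^sub>\<le>\<^sub>0) \<and> (\<forall>z\<in>- \<real>\<^sub>\<le>\<^sub>0. exp (L z) = f z) \<and>
     (\<forall>x::real. x > 0 \<longrightarrow> L (of_real x) \<in> \<real>)"

text \<open>Values on the cut are irrelevant. Existence for the functions considered here is proved below.\<close>

definition log_branch :: "(complex \<Rightarrow> complex) \<Rightarrow> complex \<Rightarrow> complex" where
  "log_branch f = (SOME L. is_log_branch f L)"

lemma class_E_log_branch:
  assumes "f \<in> class_E p"
  shows "is_log_branch f (log_branch f)"
proof -
  let ?S = "- \<real>\<^sub>\<le>\<^sub>0 :: complex set"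
  have S: "?S = - (complex_of_real ` {..0})"
    by (auto simp: nonpos_Reals_def)
  have holf: "f holomorphic_on ?S"
    using assms holomorphic_on_subset by (auto simp: class_E_def)
  have con: "contractible ?S"
    unfolding S by (intro starlike_imp_contractible starlike_slotted_complex_plane_left)
  have nz: "f z \<noteq> 0" if "z \<in> ?S" for z
    using assms that by (auto simp: class_E_def)
  obtain G where G: "G holomorphic_on ?S" "\<And>z. z \<in> ?S \<Longrightarrow> f z = exp (G z)"
  proof (rule contractible_imp_holomorphic_log[OF holf con nz])
    fix F assume "F holomorphic_on ?S" "\<And>z. z \<in> ?S \<Longrightarrow> f z = exp (F z)"
    thus thesis by (rule that)
  qed
  have pos: "complex_of_real ` {0<..} \<subseteq> ?S"
    by (auto simp: complex_nonpos_Reals_iff)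
  have int: "\<exists>k::int. Im (G (of_real x)) = of_int k * (2 * pi)" if "x > 0" for x :: real
  proof -
    have fx: "f (of_real x) = exp (G (of_real x))" using that pos G(2) by auto
    have "f (of_real x) \<in> \<real>" "Re (f (of_real x)) > 0"
      using assms that by (auto simp: class_E_def)
    hence "Im (exp (G (of_real x))) = 0" "Re (exp (G (of_real x))) > 0"
      using fx by (auto simp: complex_is_Real_iff)
    hence s: "sin (Im (G (of_real x))) = 0" and c: "cos (Im (G (of_real x))) > 0"
      by (auto simp: Im_exp Re_exp zero_less_mult_iff)
    from s c have "cos (Im (G (of_real x))) = 1"
      using sin_zero_abs_cos_one[OF s] by simp
    then obtain k :: int where "Im (G (of_real x)) = of_int k * 2 * pi"
      using cos_one_2pi_int by blast
    thus ?thesis by (intro exI[of _ k]) simp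
  qed
  define u where "u = (\<lambda>x::real. Im (G (of_real x)) / (2 * pi))"
  have contG: "continuous_on ?S G"
    using G(1) holomorphic_on_imp_continuous_on by blast
  have contu: "continuous_on {0<..} u"
    unfolding u_def using pos
    by (intro continuous_intros continuous_on_compose2[OF contG]) auto
  have uint: "u x \<in> \<int>" if "x > 0" for x
    using int[OF that] by (auto simp: u_def)
  have "u constant_on {0<..}"
  proof (rule continuous_discrete_range_constant[OF _ contu])
    show "connected {0::real<..}" by simp
    fix x :: real assume x: "x \<in> {0<..}"
    show "\<exists>e>0. \<forall>y. y \<in> {0<..} \<and> u y \<noteq> u x \<longrightarrow> e \<le> norm (u y - u x)"
    proof (intro exI[of _ 1] conjI allI impI)
      fix y assume y: "y \<in> {0<..} \<and> u y \<noteq> u x"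
      have "u y - u x \<in> \<int>" using x y uint by auto
      thus "1 \<le> norm (u y - u x)" using y
        using Ints_nonzero_abs_ge1[of "u y - u x"] by simp
    qed simp
  qed
  then obtain c where c: "\<And>x. x > 0 \<Longrightarrow> u x = c"
    by (auto simp: constant_on_def)
  have "c \<in> \<int>" using c[of 1] uint[of 1] by simp
  then obtain k :: int where k: "c = of_int k" by (auto elim: Ints_cases)
  define L where "L = (\<lambda>z. G z - of_int k * (2 * of_real pi * \<i>))"
  have "is_log_branch f L"
    unfolding is_log_branch_def
  proof (intro conjI ballI allI impI)
    show "L holomorphic_on ?S" unfolding L_def by (intro holomorphic_intros G(1))
    fix z :: complex assume z: "z \<in> ?S"
    have "exp (of_int k * (2 * of_real pi * \<i>)) = (1::complex)"
      using exp_integer_2pi[of "of_int k"] by (simp add: mult_ac)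
    thus "exp (L z) = f z" using G(2)[OF z] by (simp add: L_def exp_diff)
  next
    fix x :: real assume "x > 0"
    hence "Im (G (of_real x)) = of_int k * (2 * pi)"
      using c[of x] k by (simp add: u_def field_simps)
    thus "L (of_real x) \<in> \<real>" by (simp add: complex_is_Real_iff L_def)
  qed
  thus ?thesis unfolding log_branch_def by (rule someI[where P = "is_log_branch f"])
qed

definition W_fun :: "(complex \<Rightarrow> complex) \<Rightarrow> nat \<Rightarrow> (nat \<Rightarrow> real) \<Rightarrow> (nat \<Rightarrow> real) \<Rightarrow> complex \<Rightarrow> complex" where
  "W_fun f n a b z = (\<Prod>k=1..n. f (z + of_real (a k))) / (\<Prod>k=1..n. f (z + of_real (b k)))"

definition log_W :: "(complex \<Rightarrow> complex) \<Rightarrow> nat \<Rightarrow> (nat \<Rightarrow> real) \<Rightarrow> (nat \<Rightarrow> real) \<Rightarrow> complex \<Rightarrow> complex" where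
  "log_W f n a b z =
     (\<Sum>k=1..n. log_branch f (z + of_real (a k)) - log_branch f (z + of_real (b k)))"

lemma exp_log_W:
  assumes f: "f \<in> class_E p" and a: "\<forall>k\<in>{1..n}. 0 \<le> a k" and b: "\<forall>k\<in>{1..n}. 0 \<le> b k"
    and z: "Re z > 0"
  shows "exp (log_W f n a b z) = W_fun f n a b z"
proof -
  have *: "exp (log_branch f (z + of_real t)) = f (z + of_real t)" if "t \<ge> 0" for t :: real
    using class_E_log_branch[OF f] that z by (auto simp: is_log_branch_def complex_nonpos_Reals_iff)
  have "exp (log_W f n a b z) = (\<Prod>k=1..n. f (z + of_real (a k)) / f (z + of_real (b k)))"
    unfolding log_W_def exp_sum[OF finite_atLeastAtMost]
    by (intro prod.cong refl) (use a b * in \<open>auto simp: exp_diff\<close>)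
  thus ?thesis by (simp add: W_fun_def prod_dividef)
qed

definition h_fun :: "enat \<Rightarrow> (nat \<Rightarrow> real) \<Rightarrow> real \<Rightarrow> real" where
  "h_fun N lam s = (\<Sum>\<^sub>\<infinity>m\<in>indices N. exp (- lam m * s))"

definition g_fun :: "nat \<Rightarrow> (nat \<Rightarrow> real) \<Rightarrow> (nat \<Rightarrow> real) \<Rightarrow> real \<Rightarrow> real" where
  "g_fun n a b s = 1 / s\<^sup>2 * (\<Sum>k=1..n. exp (- s * a k) - exp (- s * b k))"

definition rho_fun :: "nat \<Rightarrow> (nat \<Rightarrow> real) \<Rightarrow> (nat \<Rightarrow> real) \<Rightarrow> real \<Rightarrow> real" where
  "rho_fun n a b t = (\<Sum>k=1..n. (t - a k) * indicator {a k..} t) - (\<Sum>k=1..n. (t - b k) * indicator {b k..} t)"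

definition phi_fun :: "enat \<Rightarrow> (nat \<Rightarrow> real) \<Rightarrow> nat \<Rightarrow> (nat \<Rightarrow> real) \<Rightarrow> (nat \<Rightarrow> real) \<Rightarrow> real \<Rightarrow> real" where
  "phi_fun N lam n a b t = (\<Sum>\<^sub>\<infinity>m\<in>indices N. rho_fun n a b (t - lam m))"

text \<open>\<open>b \<prec>\<^sub>w a\<close>, for sequences in non-decreasing order.\<close>

definition weak_supermaj :: "nat \<Rightarrow> (nat \<Rightarrow> real) \<Rightarrow> (nat \<Rightarrow> real) \<Rightarrow> bool" where
  "weak_supermaj n b a \<longleftrightarrow> (\<forall>m\<in>{1..n}. (\<Sum>k=1..m. a k) \<le> (\<Sum>k=1..m. b k))"

definition gen_stieltjes :: "real \<Rightarrow> (real \<Rightarrow> real) \<Rightarrow> bool" where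
  "gen_stieltjes l F \<longleftrightarrow> l > 0 \<and>
     (\<exists>(\<mu>::real measure) (c::real). sets \<mu> = sets (restrict_space borel {0..}) \<and> c \<ge> 0 \<and>
        (\<forall>x>0. integrable \<mu> (\<lambda>t. 1 / (t + x) powr l) \<and>
               F x = (\<integral>t. 1 / (t + x) powr l \<partial>\<mu>) + c))"

definition gen_stieltjes_complex :: "real \<Rightarrow> (complex \<Rightarrow> complex) \<Rightarrow> bool" where
  "gen_stieltjes_complex l F \<longleftrightarrow>
     (\<exists>G. gen_stieltjes l G \<and> (\<forall>x::real. x > 0 \<longrightarrow> F (of_real x) = of_real (G x)))"

end

theory Submission
  imports Defs
begin

text \<open>
  Write the difference of logarithms at \<open>z + c\<close> and at \<open>z\<close> as an integral over \<open>{0..c}\<close> and all three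
  expressions of the theorem become the same number. Let
  \<open>D c y = (\<integral>u\<in>{0..c}. 1 / (y + u) ^ (p + 1))\<close> (\<open>recip_power_integral\<close>) and
  \<open>Z c = (\<Sum>m. D c (z + \<lambda>\<^sub>m))\<close> (\<open>zero_sum\<close>). Up to signs and factorials each expression equals
  \<open>\<Sum>k. Z (b k) - Z (a k)\<close>:

  \<^item> The derivative. In the Hadamard product of \<open>f\<close> all exponents are polynomials of degree at most
    the genus \<open>p\<close>, so the derivative of order \<open>p + 1\<close> of \<open>log f\<close> only sees the zeros and is
    \<open>(-1) ^ p * p! * (\<Sum>m. 1 / (w + \<lambda>\<^sub>m) ^ (p + 1))\<close> (\<open>class_E_zero_sums\<close>). Integrating from \<open>z\<close> to
    \<open>z + c\<close> gives \<open>Z c\<close> (\<open>deriv_difference_eq_zero_sum\<close>). The Hadamard product supplies its own list of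
    zeros; that it is a rearrangement of the given list follows by comparing multiplicities
    (\<open>hadamard_zero_count\<close>, \<open>ex_bij_betw_of_equal_counts\<close>).
  \<^item> The Laplace integral. As the lists \<open>a\<close> and \<open>b\<close> have the same length, \<open>s * g s\<close> is the sum of the
    differences of \<open>(1 - exp (- s * c)) / s = (\<integral>u\<in>{0..c}. exp (- s * u))\<close> at \<open>c = b k\<close> and \<open>c = a k\<close>.
    Fubini and \<open>(\<integral>s. s ^ p * exp (- s * y)) = p! / y ^ (p + 1)\<close> turn each term into \<open>p! * Z c\<close>
    (\<open>laplace_endpoint\<close>, \<open>laplace_sum\<close>).
  \<^item> The Stieltjes integral. Likewise \<open>\<rho>\<close> is a sum of differences of the functions
    \<open>ramp c t = (\<integral>u\<in>{0..c}. indicator {u<..} t)\<close>, and Fubini gives \<open>Z c / (p + 1)\<close>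
    (\<open>stieltjes_endpoint\<close>, \<open>stieltjes_sum\<close>).

  Sums and integrals may be interchanged because every summand is dominated by a multiple of
  \<open>1 / (Re z + \<lambda>\<^sub>m) ^ (p + 1)\<close>, which is summable as the genus is \<open>p\<close>. Under the majorisation
  hypothesis \<open>\<rho>\<close>, hence \<open>\<phi>\<close>, is nonnegative (\<open>rho_fun_nonneg\<close>), and the Stieltjes integral then
  exhibits the representing measure, with density \<open>\<Gamma>(p + 2) * \<phi>\<close>.
\<close>

section \<open>Canonical products\<close>

text \<open>A canonical product is parametrised by the reciprocals \<open>x m\<close> of its zeros. The value
  \<open>x m = 0\<close> stands for an absent factor, so finite and infinite products are treated alike, and
  a finite set of factors is removed by setting the corresponding \<open>x m\<close> to \<open>0\<close>.\<close>

locale canonical_product =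
  fixes q :: nat and x :: "nat \<Rightarrow> complex"
  assumes summable_recip: "summable (\<lambda>m. norm (x m) ^ Suc q)"
begin

definition P :: "complex \<Rightarrow> complex" where
  "P z = (\<Prod>m. weierstrass_factor q (z * x m))"

lemma recip_tendsto_0: "x \<longlonglongrightarrow> 0"
proof (rule LIMSEQ_I)
  fix r :: real assume r: "r > 0"
  have "eventually (\<lambda>m. norm (x m) ^ Suc q < r ^ Suc q) sequentially"
    using order_tendstoD(2)[OF summable_LIMSEQ_zero[OF summable_recip]] r by simp
  hence "eventually (\<lambda>m. norm (x m) < r) sequentially"
    by eventually_elim (rule power_less_imp_less_base[OF _ less_imp_le[OF r]])
  thus "\<exists>n0. \<forall>n\<ge>n0. norm (x n - 0) < r"
    by (simp add: eventually_sequentially)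
qed

lemma eventually_small:
  assumes "R > 0"
  shows "eventually (\<lambda>m. R * norm (x m) \<le> 1 / 2) sequentially"
proof -
  have "(\<lambda>m. R * norm (x m)) \<longlonglongrightarrow> R * norm (0::complex)"
    by (intro tendsto_intros recip_tendsto_0)
  hence "eventually (\<lambda>m. R * norm (x m) < 1 / 2) sequentially"
    by (rule order_tendstoD) simp
  thus ?thesis by eventually_elim simp
qed

lemma eventually_factor_bound:
  assumes "R > 0"
  shows "\<forall>\<^sub>F m in sequentially. \<forall>z\<in>cball 0 R.
           norm (weierstrass_factor q (z * x m) - 1) \<le> 3 * R ^ Suc q * norm (x m) ^ Suc q"
  using eventually_small[OF assms]
proof eventually_elim
  case (elim m)
  show ?case
  proof
    fix z :: complex assume z: "z \<in> cball 0 R"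
    have le: "norm (z * x m) \<le> R * norm (x m)"
      using z by (auto simp: norm_mult intro: mult_right_mono)
    hence "norm (weierstrass_factor q (z * x m) - 1) \<le> 3 * norm (z * x m) ^ Suc q"
      using elim by (intro weierstrass_factor_bound) simp
    also have "\<dots> \<le> 3 * (R * norm (x m)) ^ Suc q"
      by (intro mult_left_mono power_mono le) auto
    finally show "norm (weierstrass_factor q (z * x m) - 1) \<le> 3 * R ^ Suc q * norm (x m) ^ Suc q"
      by (simp only: power_mult_distrib mult.assoc)
  qed
qed

lemma has_prod_P: "(\<lambda>m. weierstrass_factor q (z * x m)) has_prod P z"
proof -
  let ?R = "norm z + 1"
  have "summable (\<lambda>m. norm (weierstrass_factor q (z * x m) - 1))"
  proof (rule summable_comparison_test_ev)
    have "?R > 0" by (simp add: add_nonneg_pos)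
    from eventually_factor_bound[OF this]
    show "\<forall>\<^sub>F m in sequentially. norm (norm (weierstrass_factor q (z * x m) - 1))
            \<le> 3 * ?R ^ Suc q * norm (x m) ^ Suc q"
      by eventually_elim (auto simp: dist_norm)
  qed (intro summable_mult summable_recip)
  hence "convergent_prod (\<lambda>m. weierstrass_factor q (z * x m))"
    by (intro abs_convergent_prod_imp_convergent_prod) (simp add: abs_convergent_prod_conv_summable)
  thus ?thesis unfolding P_def by (rule convergent_prod_has_prod)
qed

lemma uniform_limit_P:
  assumes "R > 0"
  shows "uniform_limit (cball 0 R) (\<lambda>n z. \<Prod>m<n. weierstrass_factor q (z * x m)) P sequentially"
proof -
  have "uniformly_convergent_on (cball 0 R) (\<lambda>n z. \<Prod>m<n. weierstrass_factor q (z * x m))"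
  proof (rule uniformly_convergent_on_prod')
    show "uniformly_convergent_on (cball 0 R)
            (\<lambda>n z. \<Sum>m<n. norm (weierstrass_factor q (z * x m) - 1))"
    proof (rule Weierstrass_m_test'_ev)
      show "\<forall>\<^sub>F m in sequentially. \<forall>z\<in>cball 0 R. norm (norm (weierstrass_factor q (z * x m) - 1))
              \<le> 3 * R ^ Suc q * norm (x m) ^ Suc q"
        using eventually_factor_bound[OF assms] by simp
    qed (intro summable_mult summable_recip)
  qed (simp_all add: weierstrass_factor_continuous_on continuous_on_mult continuous_on_id)
  then obtain g where
    g: "uniform_limit (cball 0 R) (\<lambda>n z. \<Prod>m<n. weierstrass_factor q (z * x m)) g sequentially"
    by (auto simp: uniformly_convergent_on_def)
  have "g z = P z" if z: "z \<in> cball 0 R" for z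
  proof (rule LIMSEQ_unique)
    show "(\<lambda>n. \<Prod>m<n. weierstrass_factor q (z * x m)) \<longlonglongrightarrow> g z"
      using g z by (rule tendsto_uniform_limitI)
    have "(\<lambda>n. \<Prod>m\<le>n. weierstrass_factor q (z * x m)) \<longlonglongrightarrow> P z"
      using convergent_prod_LIMSEQ[of "\<lambda>m. weierstrass_factor q (z * x m)"] has_prod_P[of z]
      by (simp add: has_prod_iff)
    thus "(\<lambda>n. \<Prod>m<n. weierstrass_factor q (z * x m)) \<longlonglongrightarrow> P z"
      by (subst (asm) lessThan_Suc_atMost[symmetric]) (rule LIMSEQ_imp_Suc)
  qed
  hence "uniform_limit (cball 0 R) (\<lambda>n z. \<Prod>m<n. weierstrass_factor q (z * x m)) g sequentially \<longleftrightarrow>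
         uniform_limit (cball 0 R) (\<lambda>n z. \<Prod>m<n. weierstrass_factor q (z * x m)) P sequentially"
    by (intro uniform_limit_cong') auto
  thus ?thesis using g by (rule iffD1)
qed

lemma holomorphic_P: "P holomorphic_on UNIV"
proof (rule holomorphic_uniform_sequence)
  show "(\<lambda>z. \<Prod>m<n. weierstrass_factor q (z * x m)) holomorphic_on UNIV" for n
    by (intro holomorphic_intros)
  fix z :: complex
  have "0 < norm z + 1" by (simp add: add_nonneg_pos)
  from uniform_limit_P[OF this]
  have "uniform_limit (cball z 1) (\<lambda>n z. \<Prod>m<n. weierstrass_factor q (z * x m)) P sequentially"
    by (rule uniform_limit_on_subset) (simp add: cball_subset_cball_iff)
  thus "\<exists>d>0. cball z d \<subseteq> UNIV \<and>
          uniform_limit (cball z d) (\<lambda>n z. \<Prod>m<n. weierstrass_factor q (z * x m)) P sequentially"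
    by (intro exI[of _ 1]) auto
qed simp

lemma P_eq_0_iff: "P z = 0 \<longleftrightarrow> (\<exists>m. z * x m = 1)"
  using has_prod_eq_0_iff[OF has_prod_P, of z] by auto

lemma finite_zero_index: "finite {m. w * x m = 1}"
proof -
  have "0 < norm w + 1" by (simp add: add_nonneg_pos)
  from eventually_small[OF this] obtain n0
    where n0: "\<And>m. m \<ge> n0 \<Longrightarrow> (norm w + 1) * norm (x m) \<le> 1 / 2"
    by (auto simp: eventually_sequentially)
  have "m < n0" if "w * x m = 1" for m
  proof (rule ccontr)
    assume "\<not> m < n0"
    hence "norm w * norm (x m) \<le> 1 / 2"
      using n0[of m] norm_ge_zero[of "x m"] unfolding distrib_right by linarith
    moreover have "norm w * norm (x m) = 1"
      using arg_cong[OF that, of norm] by (simp add: norm_mult)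
    ultimately show False by simp
  qed
  hence "{m. w * x m = 1} \<subseteq> {..<n0}" by auto
  thus ?thesis by (rule finite_subset) simp
qed

text \<open>Each of the finitely many factors that vanish at \<open>w\<close> contributes one factor \<open>z - w\<close>; the
  other factors form a canonical product again, and it does not vanish at \<open>w\<close>.\<close>

lemma local_factorization:
  obtains g where "g holomorphic_on UNIV" "g w \<noteq> 0"
    "\<And>z. P z = g z * (z - w) ^ card {m. w * x m = 1}"
proof -
  define K where "K = {m. w * x m = 1}"
  define y where "y = (\<lambda>m. if m \<in> K then 0 else x m)"
  have fin: "finite K" unfolding K_def by (rule finite_zero_index)
  interpret Y: canonical_product q y
    by standard (rule summable_comparison_test[OF _ summable_recip], auto simp: y_def)
  define e where "e = (\<lambda>m z. - x m * exp (\<Sum>k=1..q. (z * x m) ^ k / of_nat k))"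
  have wf: "weierstrass_factor q (z * x m) = (z - w) * e m z" if "m \<in> K" for m z
    using that by (simp add: weierstrass_factor_def e_def K_def algebra_simps)
  show ?thesis
  proof (rule that)
    show "(\<lambda>z. (\<Prod>m\<in>K. e m z) * Y.P z) holomorphic_on UNIV"
      unfolding e_def by (intro holomorphic_intros Y.holomorphic_P) auto
    have "e m w \<noteq> 0" if "m \<in> K" for m
      using that by (auto simp: e_def K_def)
    moreover have "Y.P w \<noteq> 0"
      unfolding Y.P_eq_0_iff by (auto simp: y_def K_def)
    ultimately show "(\<Prod>m\<in>K. e m w) * Y.P w \<noteq> 0"
      using fin by simp
    fix z
    have "(\<lambda>m. if m \<in> K then weierstrass_factor q (z * x m) else 1) has_prod
            (\<Prod>m\<in>K. weierstrass_factor q (z * x m))"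
      using fin by (rule has_prod_If_finite_set)
    from has_prod_mult[OF this Y.has_prod_P[of z]]
    moreover have "(if m \<in> K then weierstrass_factor q (z * x m) else 1) *
        weierstrass_factor q (z * y m) = weierstrass_factor q (z * x m)" for m
      by (simp add: y_def)
    ultimately have "(\<lambda>m. weierstrass_factor q (z * x m)) has_prod
            ((\<Prod>m\<in>K. weierstrass_factor q (z * x m)) * Y.P z)"
      by simp
    hence "P z = (\<Prod>m\<in>K. weierstrass_factor q (z * x m)) * Y.P z"
      using has_prod_P[of z] has_prod_unique2 by blast
    also have "(\<Prod>m\<in>K. weierstrass_factor q (z * x m)) = (\<Prod>m\<in>K. (z - w) * e m z)"
      by (intro prod.cong) (simp_all add: wf)
    also have "\<dots> = (z - w) ^ card K * (\<Prod>m\<in>K. e m z)"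
      by (simp add: prod.distrib)
    finally show "P z = (\<Prod>m\<in>K. e m z) * Y.P z * (z - w) ^ card {m. w * x m = 1}"
      by (simp add: K_def mult_ac)
  qed
qed

end

section \<open>Logarithmic derivatives of canonical products\<close>

lemma higher_deriv_sum:
  assumes "\<And>i. i \<in> I \<Longrightarrow> F i holomorphic_on S" "open S" "z \<in> S"
  shows "(deriv ^^ n) (\<lambda>w. \<Sum>i\<in>I. F i w) z = (\<Sum>i\<in>I. (deriv ^^ n) (F i) z)"
  using assms(1)
proof (induction I rule: infinite_finite_induct)
  case (insert i I)
  have "(deriv ^^ n) (\<lambda>w. F i w + (\<Sum>i\<in>I. F i w)) z =
        (deriv ^^ n) (F i) z + (deriv ^^ n) (\<lambda>w. \<Sum>i\<in>I. F i w) z"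
    using insert.prems by (intro higher_deriv_add[OF _ _ assms(2,3)] holomorphic_on_sum) auto
  thus ?case using insert by simp
qed auto

lemma higher_deriv_simple_pole:
  fixes c w :: complex
  assumes "w \<noteq> c"
  shows "(deriv ^^ n) (\<lambda>z. 1 / (z - c)) w = (-1) ^ n * fact n / (w - c) ^ Suc n"
  using assms
proof (induction n arbitrary: w)
  case (Suc n)
  have "eventually (\<lambda>z. z \<in> - {c}) (nhds w)"
    by (rule eventually_nhds_in_open) (use Suc.prems in auto)
  hence "eventually (\<lambda>z. (deriv ^^ n) (\<lambda>z. 1 / (z - c)) z = (-1) ^ n * fact n / (z - c) ^ Suc n) (nhds w)"
    by eventually_elim (use Suc.IH in auto)
  hence "deriv ((deriv ^^ n) (\<lambda>z. 1 / (z - c))) w =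
         deriv (\<lambda>z. (-1) ^ n * fact n / (z - c) ^ Suc n) w"
    by (intro deriv_cong_ev) auto
  also have "\<dots> = (-1) ^ Suc n * fact (Suc n) / (w - c) ^ Suc (Suc n)"
  proof (rule DERIV_imp_deriv)
    have D: "((\<lambda>z. (z - c) ^ Suc n) has_field_derivative of_nat (Suc n) * (w - c) ^ n) (at w)"
      by (auto intro!: derivative_eq_intros simp del: power_Suc)
    have nz: "(w - c) ^ Suc n \<noteq> 0" using Suc.prems by simp
    have eq: "(-1) ^ n * fact n * - (inverse ((w - c) ^ Suc n) * (of_nat (Suc n) * (w - c) ^ n) * inverse ((w - c) ^ Suc n)) =
       (-1) ^ Suc n * fact (Suc n) / (w - c) ^ Suc (Suc n)"
    proof -
      define d where "d = w - c"
      have "d \<noteq> 0" using Suc.prems by (simp add: d_def)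
      thus ?thesis unfolding d_def[symmetric] by (simp add: field_simps)
    qed
    from DERIV_cmult[OF DERIV_inverse'[OF D nz], of "(-1) ^ n * fact n"]
    show "((\<lambda>z. (-1) ^ n * fact n / (z - c) ^ Suc n) has_field_derivative
            (-1) ^ Suc n * fact (Suc n) / (w - c) ^ Suc (Suc n)) (at w)"
      unfolding eq divide_inverse by simp
  qed
  finally show ?case by simp
qed simp

lemma higher_deriv_poly_pderiv_eq_0:
  fixes Q :: "complex poly"
  assumes "degree Q \<le> n"
  shows "(deriv ^^ n) (poly (pderiv Q)) w = 0"
proof -
  have d: "deriv (poly R) = poly (pderiv R)" for R :: "complex poly"
    by (rule ext) (rule DERIV_imp_deriv[OF poly_DERIV])
  have "(deriv ^^ n) (poly R) = poly ((pderiv ^^ n) R)" for R :: "complex poly"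
    by (induction n) (simp_all add: d)
  moreover have "degree ((pderiv ^^ n) Q) = 0"
    using assms by (simp add: degree_higher_pderiv)
  hence "(pderiv ^^ Suc n) Q = 0"
    by (simp add: pderiv_eq_0_iff)
  ultimately show ?thesis by (simp add: funpow_swap1)
qed

lemma logderiv_weierstrass_factor:
  assumes "w * x \<noteq> 1"
  shows "deriv (\<lambda>z. weierstrass_factor q (z * x)) w / weierstrass_factor q (w * x)
           = x / (w * x - 1) + (\<Sum>j<q. x ^ Suc j * w ^ j)"
proof -
  let ?S = "\<lambda>u. \<Sum>k=1..q. u ^ k / of_nat k"
  have S: "((\<lambda>z. ?S (z * x)) has_field_derivative (\<Sum>j<q. x ^ Suc j * w ^ j)) (at w)"
  proof -
    have "((\<lambda>z. ?S (z * x)) has_field_derivative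
            (\<Sum>k=1..q. of_nat k * (w * x) ^ (k - 1) * x / of_nat k)) (at w)"
    proof (rule DERIV_sum)
      fix k
      have "((\<lambda>z. (z * x) ^ k) has_field_derivative of_nat k * (w * x) ^ (k - 1) * x) (at w)"
        by (auto intro!: derivative_eq_intros)
      thus "((\<lambda>z. (z * x) ^ k / of_nat k) has_field_derivative
              of_nat k * (w * x) ^ (k - 1) * x / of_nat k) (at w)"
        by (rule DERIV_cdivide)
    qed
    also have "(\<Sum>k=1..q. of_nat k * (w * x) ^ (k - 1) * x / of_nat k) =
               (\<Sum>j<q. of_nat (Suc j) * (w * x) ^ j * x / of_nat (Suc j))"
      by (rule sum.reindex_bij_witness[of _ Suc "\<lambda>k. k - 1"]) auto
    also have "\<dots> = (\<Sum>j<q. x ^ Suc j * w ^ j)"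
      by (intro sum.cong) (auto simp: power_mult_distrib simp del: of_nat_Suc)
    finally show ?thesis .
  qed
  have "((\<lambda>z. weierstrass_factor q (z * x)) has_field_derivative
          (- x * exp (?S (w * x)) + (1 - w * x) * (exp (?S (w * x)) * (\<Sum>j<q. x ^ Suc j * w ^ j)))) (at w)"
    unfolding weierstrass_factor_def
    by (rule derivative_eq_intros S refl | simp)+
  hence "deriv (\<lambda>z. weierstrass_factor q (z * x)) w =
          - x * exp (?S (w * x)) + (1 - w * x) * (exp (?S (w * x)) * (\<Sum>j<q. x ^ Suc j * w ^ j))"
    by (rule DERIV_imp_deriv)
  moreover have "(- x * E + (1 - w * x) * (E * T)) / ((1 - w * x) * E) = x / (w * x - 1) + T"
    if "E \<noteq> 0" for E T
  proof -
    have "(- x * E + (1 - w * x) * (E * T)) / ((1 - w * x) * E) = - x / (1 - w * x) + T"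
      using assms that by (simp add: add_divide_distrib diff_divide_distrib)
    also have "- x / (1 - w * x) = x / (w * x - 1)"
      by (metis minus_diff_eq minus_divide_divide minus_minus)
    finally show ?thesis .
  qed
  ultimately show ?thesis
    unfolding weierstrass_factor_def by simp
qed

text \<open>Summing the geometric series shows that the logarithmic derivative of a factor is of
  order \<open>x ^ Suc q\<close>; this is what makes the logarithmic derivative of the product converge.\<close>

lemma logderiv_weierstrass_factor_closed_form:
  fixes w x :: complex
  assumes "w * x \<noteq> 1"
  shows "x / (w * x - 1) + (\<Sum>j<q. x ^ Suc j * w ^ j) = x ^ Suc q * w ^ q / (w * x - 1)"
proof -
  define G where "G = (\<Sum>j<q. (w * x) ^ j)"
  have sum: "(\<Sum>j<q. x ^ Suc j * w ^ j) = x * G"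
    by (simp add: G_def sum_distrib_left power_mult_distrib mult_ac)
  have "1 - (w * x) ^ q = (1 - w * x) * G"
    unfolding G_def by (rule one_diff_power_eq)
  hence pow: "x ^ q * w ^ q = 1 - (1 - w * x) * G"
    by (simp add: power_mult_distrib algebra_simps)
  have "x / (w * x - 1) + x * G = x * (1 - (1 - w * x) * G) / (w * x - 1)"
    using assms by (simp add: field_simps)
  thus ?thesis unfolding sum by (simp add: pow mult.assoc)
qed

text \<open>The logarithmic derivative of a factor is the simple pole \<open>1 / (z - 1 / x)\<close> plus a polynomial of
  degree less than \<open>q\<close>, which is the derivative of a polynomial of degree at most \<open>n\<close>.\<close>

lemma higher_deriv_logderiv_weierstrass_factor:
  fixes w x :: complex
  assumes wx: "w * x \<noteq> 1" and n: "q \<le> n"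
  shows "(deriv ^^ n) (\<lambda>z. x / (z * x - 1) + (\<Sum>j<q. x ^ Suc j * z ^ j)) w =
           (if x = 0 then 0 else (-1) ^ n * fact n / (w - 1 / x) ^ Suc n)"
proof (cases "x = 0")
  case False
  define R where "R = (\<Sum>k\<in>{1..q}. monom (x ^ k / of_nat k) k)"
  have "degree (monom (x ^ k / of_nat k) k) \<le> q" if "k \<in> {1..q}" for k
    by (rule order_trans[OF degree_monom_le]) (use that in auto)
  hence degR: "degree R \<le> n"
    unfolding R_def using n by (intro order_trans[OF degree_sum_le]) auto
  have R: "poly (pderiv R) z = (\<Sum>j<q. x ^ Suc j * z ^ j)" for z
  proof -
    have "poly (pderiv R) z = (\<Sum>k\<in>{1..q}. of_nat k * (x ^ k / of_nat k) * z ^ (k - 1))"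
      by (simp add: R_def higher_pderiv_sum[of 1, simplified] poly_sum pderiv_monom poly_monom)
    also have "\<dots> = (\<Sum>j<q. of_nat (Suc j) * (x ^ Suc j / of_nat (Suc j)) * z ^ j)"
      by (rule sum.reindex_bij_witness[of _ Suc "\<lambda>k. k - 1"]) auto
    finally show ?thesis by (simp del: of_nat_Suc)
  qed
  have ne: "w \<noteq> 1 / x" using wx False by (auto simp: field_simps)
  have eq: "(\<lambda>z. x / (z * x - 1) + (\<Sum>j<q. x ^ Suc j * z ^ j)) =
        (\<lambda>z. 1 / (z - 1 / x) + poly (pderiv R) z)"
    using False by (auto simp: R fun_eq_iff divide_simps)
  have "(deriv ^^ n) (\<lambda>z. 1 / (z - 1 / x) + poly (pderiv R) z) w = (deriv ^^ n) (\<lambda>z. 1 / (z - 1 / x)) w + (deriv ^^ n) (poly (pderiv R)) w"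
    by (rule higher_deriv_add[where S = "- {1 / x}"]) (use ne in \<open>auto intro!: holomorphic_intros\<close>)
  thus ?thesis
    unfolding eq using False by (simp add: higher_deriv_simple_pole[OF ne] higher_deriv_poly_pderiv_eq_0[OF degR])
qed auto

context canonical_product
begin

lemma logderiv_P_sums:
  assumes "P w \<noteq> 0"
  shows "(\<lambda>m. x m / (w * x m - 1) + (\<Sum>j<q. x m ^ Suc j * w ^ j)) sums (deriv P w / P w)"
proof -
  let ?R = "norm w + 1"
  have R: "0 < ?R" by (simp add: add_nonneg_pos)
  have "(\<lambda>m. deriv (\<lambda>z. weierstrass_factor q (z * x m)) w / weierstrass_factor q (w * x m))
          sums (deriv P w / P w)"
  proof (rule logderiv_prodinf_complex_uniform_limit)
    show "uniform_limit (ball 0 ?R) (\<lambda>n z. \<Prod>m<n. weierstrass_factor q (z * x m)) P sequentially"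
      using uniform_limit_P[OF R] by (rule uniform_limit_on_subset) auto
    show "(\<lambda>z. weierstrass_factor q (z * x m)) holomorphic_on ball 0 ?R" for m
      by (intro holomorphic_intros)
  qed (use assms in auto)
  moreover have "w * x m \<noteq> 1" for m
    using assms P_eq_0_iff by auto
  ultimately show ?thesis by (simp add: logderiv_weierstrass_factor)
qed

text \<open>If all zeros are negative, then \<open>norm (w * x m - 1) \<ge> 1\<close> in the right half plane, so there
  the series of logarithmic derivatives converges locally uniformly and may be differentiated
  termwise. From order \<open>q\<close> on the polynomial parts disappear.\<close>

lemma higher_deriv_logderiv_P_sums:
  assumes x: "\<And>m. x m = - of_real (r m)" "\<And>m. r m \<ge> 0" and n: "q \<le> n" and w: "Re w > 0"
  shows "(\<lambda>m. if r m = 0 then 0 else (-1) ^ n * fact n / (w + of_real (1 / r m)) ^ Suc n)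
           sums (deriv ^^ n) (\<lambda>z. deriv P z / P z) w"
proof -
  define t where "t = (\<lambda>m z. x m / (z * x m - 1) + (\<Sum>j<q. x m ^ Suc j * z ^ j))"
  define R where "R = norm w + 1"
  define S where "S = {z. Re z > 0} \<inter> ball 0 R"
  have S: "open S" "w \<in> S"
    using w by (auto simp: S_def R_def open_halfspace_Re_gt)
  have ge1: "norm (z * x m - 1) \<ge> 1" if "Re z > 0" for z m
  proof -
    have "- Re (z * x m - 1) \<ge> 1" using that x(2)[of m] by (simp add: x(1))
    thus ?thesis using abs_Re_le_cmod[of "z * x m - 1"] by linarith
  qed
  have ne: "z * x m \<noteq> 1" if "Re z > 0" for z m
  proof
    assume "z * x m = 1"
    thus False using ge1[OF that, of m] by simp
  qed
  have P: "P z \<noteq> 0" if "Re z > 0" for z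
    using ne[OF that] by (simp add: P_eq_0_iff)
  have "uniform_limit S (\<lambda>n z. \<Sum>m<n. t m z) (\<lambda>z. \<Sum>m. t m z) sequentially"
  proof (rule Weierstrass_m_test)
    show "norm (t m z) \<le> R ^ q * norm (x m) ^ Suc q" if "z \<in> S" for m z
    proof -
      have z: "Re z > 0" "norm z \<le> R" using that by (auto simp: S_def)
      have "norm (t m z) = norm (x m) ^ Suc q * norm z ^ q / norm (z * x m - 1)"
        unfolding t_def logderiv_weierstrass_factor_closed_form[OF ne[OF z(1)]]
        by (simp only: norm_divide norm_mult norm_power)
      also have "\<dots> \<le> norm (x m) ^ Suc q * norm z ^ q / 1"
        by (intro divide_left_mono ge1 z) (use ne[OF z(1), of m] in auto)
      also have "\<dots> \<le> norm (x m) ^ Suc q * R ^ q / 1"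
        using z by (intro divide_right_mono mult_left_mono power_mono) auto
      finally show ?thesis by (simp add: mult_ac)
    qed
  qed (intro summable_mult summable_recip)
  moreover have "(\<Sum>m. t m z) = deriv P z / P z" if "z \<in> S" for z
    using logderiv_P_sums[OF P, of z] that by (auto simp: t_def S_def sums_iff)
  hence "uniform_limit S (\<lambda>n z. \<Sum>m<n. t m z) (\<lambda>z. \<Sum>m. t m z) sequentially \<longleftrightarrow>
         uniform_limit S (\<lambda>n z. \<Sum>m<n. t m z) (\<lambda>z. deriv P z / P z) sequentially"
    by (intro uniform_limit_cong') auto
  ultimately have ul: "uniform_limit S (\<lambda>n z. \<Sum>m<n. t m z) (\<lambda>z. deriv P z / P z) sequentially"
    by simp
  have hol: "t m holomorphic_on S" for m
    unfolding t_def using ne by (intro holomorphic_intros) (auto simp: S_def)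
  have "(\<lambda>k. (deriv ^^ n) (\<lambda>z. \<Sum>m<k. t m z) w) \<longlonglongrightarrow> (deriv ^^ n) (\<lambda>z. deriv P z / P z) w"
    by (rule higher_deriv_complex_uniform_limit[OF ul _ _ S])
       (auto intro!: always_eventually holomorphic_on_sum hol)
  also have "(\<lambda>k. (deriv ^^ n) (\<lambda>z. \<Sum>m<k. t m z) w) = (\<lambda>k. \<Sum>m<k. (deriv ^^ n) (t m) w)"
    by (intro ext higher_deriv_sum[OF hol S])
  finally have "(\<lambda>m. (deriv ^^ n) (t m) w) sums (deriv ^^ n) (\<lambda>z. deriv P z / P z) w"
    by (simp add: sums_def)
  also have "(\<lambda>m. (deriv ^^ n) (t m) w) =
      (\<lambda>m. if r m = 0 then 0 else (-1) ^ n * fact n / (w + of_real (1 / r m)) ^ Suc n)"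
    unfolding t_def higher_deriv_logderiv_weierstrass_factor[OF ne[OF w] n]
    by (auto simp: x(1) fun_eq_iff)
  finally show ?thesis .
qed

end

section \<open>The logarithmic derivative of a function of the class\<close>

text \<open>Two lists in which every value occurs equally often are rearrangements of each other. This
  transfers sums from the zeros of the Hadamard product to an arbitrary list of the zeros.\<close>

lemma ex_bij_betw_of_equal_counts:
  assumes fin: "\<And>v. finite {i\<in>I. f i = v}" "\<And>v. finite {j\<in>J. g j = v}"
    and card: "\<And>v. card {i\<in>I. f i = v} = card {j\<in>J. g j = v}"
  obtains \<pi> where "bij_betw \<pi> I J" "\<And>i. i \<in> I \<Longrightarrow> g (\<pi> i) = f i"
proof -
  have "\<forall>v. \<exists>\<sigma>. bij_betw \<sigma> {i\<in>I. f i = v} {j\<in>J. g j = v}"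
    using fin card by (auto intro: finite_same_card_bij)
  then obtain \<sigma> where \<sigma>: "\<And>v. bij_betw (\<sigma> v) {i\<in>I. f i = v} {j\<in>J. g j = v}"
    by metis
  define \<pi> where "\<pi> = (\<lambda>i. \<sigma> (f i) i)"
  have \<pi>: "\<pi> i \<in> J \<and> g (\<pi> i) = f i" if "i \<in> I" for i
    using bij_betw_apply[OF \<sigma>[of "f i"], of i] that by (auto simp: \<pi>_def)
  have "inj_on \<pi> I"
  proof (rule inj_onI)
    fix i i' assume i: "i \<in> I" "i' \<in> I" and eq: "\<pi> i = \<pi> i'"
    hence v: "f i' = f i" using \<pi> by metis
    hence "\<sigma> (f i) i = \<sigma> (f i) i'" using eq by (simp add: \<pi>_def)
    thus "i = i'"
      using \<sigma>[of "f i"] i v by (auto simp: bij_betw_def dest: inj_onD)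
  qed
  moreover have "\<pi> ` I = J"
  proof
    show "J \<subseteq> \<pi> ` I"
    proof
      fix j assume j: "j \<in> J"
      hence "j \<in> \<sigma> (g j) ` {i\<in>I. f i = g j}"
        using \<sigma>[of "g j"] by (auto simp: bij_betw_def)
      then obtain i where i: "i \<in> I" "f i = g j" "\<sigma> (g j) i = j" by auto
      hence "\<pi> i = j" unfolding \<pi>_def by simp
      thus "j \<in> \<pi> ` I" using i(1) by blast
    qed
  qed (use \<pi> in auto)
  ultimately show ?thesis using \<pi> by (intro that[of \<pi>]) (auto simp: bij_betw_def)
qed

lemma indices_eq: "indices N = Suc ` {m. Suc m \<in> indices N}"
proof -
  have "m \<in> Suc ` {m. Suc m \<in> indices N}" if "m \<in> indices N" for m
    using that by (cases m) (auto simp: indices_def)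
  thus ?thesis by auto
qed

text \<open>The points \<open>\<alpha> m\<close> of the Hadamard product are nonzero zeros of \<open>f\<close>, hence negative numbers; the
  canonical product can therefore be parametrised by \<open>r m = - 1 / \<alpha> m \<ge> 0\<close>.\<close>

lemma has_genus_canonical_product:
  assumes gen: "has_genus f p" and zeros: "\<And>z. f z = 0 \<Longrightarrow> z \<in> \<real>\<^sub>\<le>\<^sub>0"
  obtains k Q q r where
    "canonical_product q (\<lambda>m. - of_real (r m))" "\<And>m. r m \<ge> 0" "q \<le> p" "degree Q \<le> p"
    "\<And>z. f z = z ^ k * exp (poly Q z) * canonical_product.P q (\<lambda>m. - of_real (r m)) z"
proof -
  from gen obtain k :: nat and Q :: "complex poly" and N :: enat and \<alpha> :: "nat \<Rightarrow> complex" and q :: nat where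
    nz: "\<forall>m\<in>indices N. \<alpha> m \<noteq> 0" and
    summ: "(\<lambda>m. 1 / norm (\<alpha> m) ^ (q + 1)) summable_on indices N" and
    f: "\<And>z. f z = z ^ k * exp (poly Q z) *
          (\<Prod>m. if Suc m \<in> indices N then weierstrass_factor q (z / \<alpha> (Suc m)) else 1)" and
    p: "p = max (degree Q) q"
    unfolding has_genus_def by blast
  define x where "x = (\<lambda>m. if Suc m \<in> indices N then 1 / \<alpha> (Suc m) else 0)"
  interpret canonical_product q x
  proof
    have "(\<lambda>m. 1 / norm (\<alpha> (Suc m)) ^ (q + 1)) summable_on {m. Suc m \<in> indices N}"
      using summ summable_on_reindex[of Suc "{m. Suc m \<in> indices N}" "\<lambda>m. 1 / norm (\<alpha> m) ^ (q + 1)"]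
      by (simp add: indices_eq[symmetric] o_def)
    hence "(\<lambda>m. norm (x m) ^ Suc q) summable_on {m. Suc m \<in> indices N}"
      by (subst summable_on_cong[where g = "\<lambda>m. 1 / norm (\<alpha> (Suc m)) ^ (q + 1)"])
         (simp_all add: x_def norm_divide power_divide)
    hence "(\<lambda>m. norm (x m) ^ Suc q) summable_on UNIV"
      by (subst summable_on_cong_neutral[where T = "{m. Suc m \<in> indices N}" and g = "\<lambda>m. norm (x m) ^ Suc q"])
         (simp_all add: x_def)
    thus "summable (\<lambda>m. norm (x m) ^ Suc q)"
      by (rule summable_on_imp_summable)
  qed
  have P: "P z = (\<Prod>m. if Suc m \<in> indices N then weierstrass_factor q (z / \<alpha> (Suc m)) else 1)" for z
    unfolding P_def by (rule prodinf_cong) (auto simp: x_def)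
  have real: "x m = - of_real (- Re (x m)) \<and> - Re (x m) \<ge> 0" for m
  proof (cases "x m = 0")
    case False
    hence "P (1 / x m) = 0" unfolding P_eq_0_iff by (intro exI[of _ m]) simp
    hence "f (1 / x m) = 0" using f[of "1 / x m"] P by simp
    hence "1 / x m \<in> \<real>\<^sub>\<le>\<^sub>0" by (rule zeros)
    then obtain t where t: "t \<le> 0" "1 / x m = of_real t" by (auto simp: nonpos_Reals_def)
    have "x m = 1 / (1 / x m)" by simp
    also have "\<dots> = of_real (1 / t)" unfolding t(2) by simp
    finally have xm: "x m = of_real (1 / t)" .
    show ?thesis unfolding xm using t(1) by (simp add: divide_le_0_iff)
  qed auto
  hence x: "(\<lambda>m. - of_real (- Re (x m))) = x"
    by (intro ext sym[OF conjunct1])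
  show ?thesis
  proof (rule that)
    show "canonical_product q (\<lambda>m. - of_real (- Re (x m)))"
      unfolding x by (rule canonical_product_axioms)
    show "- Re (x m) \<ge> 0" for m using real by blast
    show "f z = z ^ k * exp (poly Q z) * canonical_product.P q (\<lambda>m. - of_real (- Re (x m))) z" for z
      unfolding x using f[of z] P[of z] by simp
  qed (use p in auto)
qed

text \<open>The zeros of \<open>z ^ k * exp (poly Q z) * P z\<close>, listed as \<open>k\<close> copies of \<open>0\<close> followed by the
  zeros of the canonical product.\<close>

definition hadamard_indices :: "nat \<Rightarrow> (nat \<Rightarrow> real) \<Rightarrow> (nat + nat) set" where
  "hadamard_indices k r = {..<k} <+> {m. r m \<noteq> 0}"

definition hadamard_zero :: "(nat \<Rightarrow> real) \<Rightarrow> nat + nat \<Rightarrow> real" where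
  "hadamard_zero r = case_sum (\<lambda>_. 0) (\<lambda>m. 1 / r m)"

text \<open>Dividing the factors that vanish at \<open>w\<close> out of \<open>z ^ k\<close> and of the canonical product leaves a
  holomorphic function that does not vanish at \<open>w\<close>, so the number of these factors is the order of the zero.\<close>

lemma hadamard_zero_count:
  assumes P: "canonical_product q (\<lambda>m. - of_real (r m))" and r: "\<And>m. r m \<ge> 0"
    and f: "\<And>z. f z = z ^ k * exp (poly Q z) * canonical_product.P q (\<lambda>m. - of_real (r m)) z"
  shows "finite {i\<in>hadamard_indices k r. - of_real (hadamard_zero r i) = w}"
    and "int (card {i\<in>hadamard_indices k r. - of_real (hadamard_zero r i) = w}) =
           (if f w = 0 then zorder f w else 0)"
proof -
  interpret canonical_product q "\<lambda>m. - of_real (r m)" by (rule P)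
  let ?K = "{m. w * (- of_real (r m)) = 1}"
  let ?A = "{i\<in>hadamard_indices k r. - of_real (hadamard_zero r i) = w}"
  define l where "l = (if w = 0 then k else 0)"
  have K: "m \<in> ?K \<longleftrightarrow> r m \<noteq> 0 \<and> - of_real (1 / r m) = w" for m
    using eq_divide_eq[of w 1 "- of_real (r m)"] by (cases "r m = 0") auto
  have A: "?A = {..<l} <+> ?K"
  proof (rule set_eqI)
    fix i :: "nat + nat"
    show "i \<in> ?A \<longleftrightarrow> i \<in> {..<l} <+> ?K"
    proof (cases i)
      case (Inl j)
      thus ?thesis by (auto simp: hadamard_indices_def hadamard_zero_def l_def)
    next
      case (Inr m)
      have "Inr m \<in> {..<l} <+> ?K \<longleftrightarrow> m \<in> ?K" by blast
      also note K
      finally show ?thesis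
        using Inr by (auto simp: hadamard_indices_def hadamard_zero_def)
    qed
  qed
  show "finite ?A" unfolding A using finite_zero_index by simp
  have card: "card ?A = l + card ?K"
    unfolding A by (subst card_Plus) (use finite_zero_index in auto)
  obtain g where g: "g holomorphic_on UNIV" "g w \<noteq> 0" "\<And>z. P z = g z * (z - w) ^ card ?K"
    by (rule local_factorization[of w]) (rule that)
  define e where "e = (\<lambda>z. (if w = 0 then 1 else z ^ k) * exp (poly Q z) * g z)"
  have e: "e holomorphic_on UNIV"
    unfolding e_def using g(1) by (cases "w = 0") (auto intro!: holomorphic_intros)
  have ew: "e w \<noteq> 0" using g(2) by (auto simp: e_def)
  have fe: "f z = e z * (z - w) ^ card ?A" for z
    by (simp add: f g(3) e_def card l_def power_add mult_ac)
  have "zorder f w = int (card ?A)"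
    by (rule zorder_eqI[OF open_UNIV _ e ew]) (auto simp: fe)
  moreover have "f w = 0 \<longleftrightarrow> card ?A \<noteq> 0"
    using ew by (auto simp: fe)
  ultimately show "int (card ?A) = (if f w = 0 then zorder f w else 0)"
    by auto
qed

text \<open>The reciprocals of the zeros are summable with the exponent \<open>Suc q\<close>. The shift by \<open>x > 0\<close> keeps the
  terms bounded by \<open>1 / x\<close>, which allows the larger exponent \<open>Suc p\<close> and absorbs zeros at \<open>0\<close>.\<close>

lemma summable_on_recip_power_shift:
  fixes x :: real
  assumes "canonical_product q (\<lambda>m. - of_real (r m))" "\<And>m. r m \<ge> 0" "q \<le> p" "x > 0"
  shows "(\<lambda>i. 1 / (x + hadamard_zero r i) ^ Suc p) summable_on hadamard_indices k r"
proof -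
  interpret canonical_product q "\<lambda>m. - of_real (r m)" by (rule assms(1))
  have "summable (\<lambda>m. r m ^ Suc q)"
    using summable_recip assms(2) by (simp add: abs_of_nonneg)
  hence "summable (\<lambda>m. r m ^ Suc q * (1 / x) ^ (p - q))"
    by (rule summable_mult2)
  hence "(\<lambda>m. r m ^ Suc q * (1 / x) ^ (p - q)) summable_on UNIV"
    using assms(2,4) by (subst summable_on_UNIV_nonneg_real_iff) auto
  hence "(\<lambda>m. r m ^ Suc q * (1 / x) ^ (p - q)) summable_on {m. r m \<noteq> 0}"
    by (rule summable_on_subset_banach) simp
  hence "(\<lambda>m. 1 / (x + 1 / r m) ^ Suc p) summable_on {m. r m \<noteq> 0}"
  proof (rule summable_on_comparison_test)
    fix m assume "m \<in> {m. r m \<noteq> 0}"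
    hence r: "r m > 0" using assms(2)[of m] by simp
    have "Suc p = Suc q + (p - q)" using assms(3) by simp
    hence "1 / (x + 1 / r m) ^ Suc p = (1 / (x + 1 / r m)) ^ Suc q * (1 / (x + 1 / r m)) ^ (p - q)"
      by (metis power_add power_one_over)
    also have "\<dots> \<le> r m ^ Suc q * (1 / x) ^ (p - q)"
    proof -
      have "1 / (x + 1 / r m) \<le> 1 / (1 / r m)" "1 / (x + 1 / r m) \<le> 1 / x"
        using r \<open>x > 0\<close>
        by (auto intro!: divide_left_mono mult_pos_pos add_pos_pos simp del: divide_divide_eq_right)
      thus ?thesis using r \<open>x > 0\<close> by (intro mult_mono power_mono) auto
    qed
    finally show "1 / (x + 1 / r m) ^ Suc p \<le> r m ^ Suc q * (1 / x) ^ (p - q)" .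
  qed (use assms in \<open>auto intro!: add_nonneg_nonneg\<close>)
  hence *: "(\<lambda>i. 1 / (x + hadamard_zero r i) ^ Suc p) summable_on Inr ` {m. r m \<noteq> 0}"
    by (subst summable_on_reindex) (auto simp: hadamard_zero_def o_def)
  have "(\<lambda>i. 1 / (x + hadamard_zero r i) ^ Suc p) summable_on Inl ` {..<k}"
    by (rule summable_on_finite) simp
  from summable_on_Un_disjoint[OF this *] show ?thesis
    unfolding hadamard_indices_def Plus_def by auto
qed

lemma norm_recip_power_shift_le:
  fixes w :: complex
  assumes "Re w > 0" "t \<ge> 0"
  shows "norm (1 / (w + of_real t) ^ n) \<le> 1 / (Re w + t) ^ n"
proof -
  have "Re w + t \<le> norm (w + of_real t)"
    using complex_Re_le_cmod[of "w + of_real t"] by simp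
  hence "(Re w + t) ^ n \<le> norm (w + of_real t) ^ n"
    using assms by (intro power_mono) auto
  moreover have "(Re w + t) ^ n > 0"
    using assms by (intro zero_less_power) auto
  ultimately show ?thesis
    unfolding norm_divide norm_power norm_one by (intro frac_le) auto
qed

lemma logderiv_hadamard_product:
  assumes P: "P holomorphic_on UNIV"
    and f: "\<And>z. f z = z ^ k * exp (poly Q z) * P z" and nz: "f z \<noteq> 0" "z \<noteq> 0"
  shows "deriv f z / f z = of_nat k * (1 / (z - 0)) + (poly (pderiv Q) z + deriv P z / P z)"
proof -
  have "(P has_field_derivative deriv P z) (at z)"
    using P by (rule holomorphic_derivI) auto
  hence "((\<lambda>z. z ^ k * exp (poly Q z) * P z) has_field_derivative
          (of_nat k * z ^ (k - 1) * exp (poly Q z) * P z + z ^ k * (exp (poly Q z) * poly (pderiv Q) z) * P z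
            + z ^ k * exp (poly Q z) * deriv P z)) (at z)"
    by (auto intro!: derivative_eq_intros simp: algebra_simps)
  moreover have "f = (\<lambda>z. z ^ k * exp (poly Q z) * P z)" using f by auto
  ultimately have "deriv f z = of_nat k * z ^ (k - 1) * exp (poly Q z) * P z
      + z ^ k * (exp (poly Q z) * poly (pderiv Q) z) * P z + z ^ k * exp (poly Q z) * deriv P z"
    using DERIV_imp_deriv by simp
  moreover have "P z \<noteq> 0" using nz(1) f by auto
  moreover have "of_nat k * z ^ (k - 1) / z ^ k = of_nat k / z"
    using nz(2) by (cases k) auto
  ultimately show ?thesis
    using nz(2) by (simp add: f add_divide_distrib)
qed

lemma is_log_branch_logderiv:
  assumes L: "is_log_branch f L" and z: "z \<notin> \<real>\<^sub>\<le>\<^sub>0" and f: "f holomorphic_on UNIV"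
  shows "deriv L z = deriv f z / f z"
proof -
  have op: "open (- \<real>\<^sub>\<le>\<^sub>0 :: complex set)" by (simp add: open_Compl)
  have "(L has_field_derivative deriv L z) (at z)"
    using L z op by (auto simp: is_log_branch_def intro!: holomorphic_derivI[where S = "- \<real>\<^sub>\<le>\<^sub>0"])
  hence D: "((\<lambda>z. exp (L z)) has_field_derivative exp (L z) * deriv L z) (at z)"
    by (rule DERIV_fun_exp)
  have "(f has_field_derivative exp (L z) * deriv L z) (at z)"
    by (rule has_field_derivative_transform_within_open[OF D op])
       (use L z in \<open>auto simp: is_log_branch_def\<close>)
  hence "deriv f z = exp (L z) * deriv L z" by (rule DERIV_imp_deriv)
  moreover have "exp (L z) = f z" using L z by (auto simp: is_log_branch_def)
  ultimately show ?thesis by (metis exp_not_eq_zero nonzero_mult_div_cancel_left)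
qed

text \<open>Only the zeros survive in the derivative of order \<open>Suc p\<close>: the polynomial \<open>Q\<close> and the
  exponents of the elementary factors have degree at most \<open>p\<close>.\<close>

lemma class_E_zero_sums:
  assumes f: "f \<in> class_E p" and zeros: "lists_zeros f N (\<lambda>m. - of_real (lam m))"
  shows "x > 0 \<Longrightarrow> (\<lambda>m. 1 / (x + lam m) ^ Suc p) summable_on indices N"
    and "Re w > 0 \<Longrightarrow> (deriv ^^ Suc p) (log_branch f) w =
           (-1) ^ p * fact p * (\<Sum>\<^sub>\<infinity>m\<in>indices N. 1 / (w + of_real (lam m)) ^ Suc p)"
proof -
  have hol: "f holomorphic_on UNIV" and gen: "has_genus f p" and nonpos: "\<And>z. f z = 0 \<Longrightarrow> z \<in> \<real>\<^sub>\<le>\<^sub>0"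
    using f by (auto simp: class_E_def)
  obtain k Q q r where P: "canonical_product q (\<lambda>m. - of_real (r m))" and r: "\<And>m. r m \<ge> 0"
    and q: "q \<le> p" and Q: "degree Q \<le> p"
    and feq: "\<And>z. f z = z ^ k * exp (poly Q z) * canonical_product.P q (\<lambda>m. - of_real (r m)) z"
  proof (rule has_genus_canonical_product[OF gen])
    show "z \<in> \<real>\<^sub>\<le>\<^sub>0" if "f z = 0" for z using that by (rule nonpos)
  qed blast
  interpret canonical_product q "\<lambda>m. - of_real (r m)" by (rule P)
  let ?I = "hadamard_indices k r" and ?z = "hadamard_zero r"
  have count: "finite {i\<in>?I. ?z i = v} \<and> finite {m\<in>indices N. lam m = v} \<and>
               card {m\<in>indices N. lam m = v} = card {i\<in>?I. ?z i = v}" for v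
  proof -
    let ?w = "- of_real v :: complex"
    have "finite {m\<in>indices N. - of_real (lam m) = ?w} \<and>
          int (card {m\<in>indices N. - of_real (lam m) = ?w}) = (if f ?w = 0 then zorder f ?w else 0)"
      using zeros[unfolded lists_zeros_def, rule_format, of ?w] .
    moreover note hadamard_zero_count[OF P r feq, of ?w]
    ultimately show ?thesis by simp
  qed
  obtain \<pi> where \<pi>: "bij_betw \<pi> (indices N) ?I" "\<And>m. m \<in> indices N \<Longrightarrow> ?z (\<pi> m) = lam m"
    by (rule ex_bij_betw_of_equal_counts[of "indices N" lam ?I ?z]) (use count in blast)+
  have shift: "(\<lambda>i. 1 / (y + ?z i) ^ Suc p) summable_on ?I" if "y > 0" for y
    using P r q that by (rule summable_on_recip_power_shift)
  show "(\<lambda>m. 1 / (x + lam m) ^ Suc p) summable_on indices N" if "x > 0"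
  proof -
    have "(\<lambda>m. 1 / (x + ?z (\<pi> m)) ^ Suc p) summable_on indices N"
      using shift[OF that]
      by (rule summable_on_reindex_bij_betw[OF \<pi>(1), of "\<lambda>i. 1 / (x + ?z i) ^ Suc p", THEN iffD2])
    thus ?thesis
      by (subst summable_on_cong[where g = "\<lambda>m. 1 / (x + ?z (\<pi> m)) ^ Suc p"]) (simp_all add: \<pi>(2))
  qed
  assume w: "Re w > 0"
  let ?c = "(-1) ^ p * fact p :: complex"
  define G where "G = (\<lambda>i. 1 / (w + of_real (?z i)) ^ Suc p)"
  have zn: "?z i \<ge> 0" for i
    using r by (auto simp: hadamard_zero_def split: sum.split)
  have "(\<lambda>i. norm (G i)) summable_on ?I"
    by (rule summable_on_comparison_test[OF shift[OF w]])
       (unfold G_def, intro norm_recip_power_shift_le w zn, simp)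
  hence summG: "G summable_on ?I" by (rule abs_summable_summable)
  define S where "S = {z. Re z > 0}"
  have S: "open S" "w \<in> S" using w by (auto simp: S_def open_halfspace_Re_gt)
  have slit: "z \<notin> \<real>\<^sub>\<le>\<^sub>0" if "z \<in> S" for z
    using that by (auto simp: S_def complex_nonpos_Reals_iff)
  have nz: "f z \<noteq> 0" "z \<noteq> 0" "P z \<noteq> 0" if "z \<in> S" for z
    using slit[OF that] nonpos feq[of z] by auto
  have L: "is_log_branch f (log_branch f)" using f by (rule class_E_log_branch)
  have holL: "log_branch f holomorphic_on S"
    using L slit by (auto simp: is_log_branch_def intro: holomorphic_on_subset)
  have holP: "P holomorphic_on S" "deriv P holomorphic_on S"
    using holomorphic_P holomorphic_on_subset S(1) by (blast intro: holomorphic_deriv)+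
  have "(deriv ^^ Suc p) (log_branch f) w = (deriv ^^ p) (deriv (log_branch f)) w"
    by (simp add: funpow_swap1)
  also have "\<dots> = (deriv ^^ p) (\<lambda>z. of_nat k * (1 / (z - 0)) + (poly (pderiv Q) z + deriv P z / P z)) w"
  proof (rule higher_deriv_transform_within_open[where S = S])
    show "(\<lambda>z. of_nat k * (1 / (z - 0)) + (poly (pderiv Q) z + deriv P z / P z)) holomorphic_on S"
      using nz holP S(1) by (intro holomorphic_intros) auto
    show "deriv (log_branch f) holomorphic_on S" using holL S(1) by (rule holomorphic_deriv)
    show "deriv (log_branch f) z = of_nat k * (1 / (z - 0)) + (poly (pderiv Q) z + deriv P z / P z)"
      if "z \<in> S" for z
      using logderiv_hadamard_product[OF holomorphic_P feq nz(1,2)[OF that]]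
            is_log_branch_logderiv[OF L slit[OF that] hol] by simp
  qed (use S in auto)
  also have "\<dots> = (deriv ^^ p) (\<lambda>z. of_nat k * (1 / (z - 0))) w +
                  (deriv ^^ p) (\<lambda>z. poly (pderiv Q) z + deriv P z / P z) w"
    using nz holP S(1) by (intro higher_deriv_add[OF _ _ S] holomorphic_intros) auto
  also have "(deriv ^^ p) (\<lambda>z. of_nat k * (1 / (z - 0))) w = of_nat k * (deriv ^^ p) (\<lambda>z. 1 / (z - 0)) w"
    using nz by (intro higher_deriv_cmult[OF _ S(2,1)] holomorphic_intros) auto
  also have "(deriv ^^ p) (\<lambda>z. 1 / (z - 0)) w = ?c / w ^ Suc p"
    using higher_deriv_simple_pole[of w 0 p] nz(2)[OF S(2)] by simp
  also have "(deriv ^^ p) (\<lambda>z. poly (pderiv Q) z + deriv P z / P z) w =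
             (deriv ^^ p) (\<lambda>z. poly (pderiv Q) z) w + (deriv ^^ p) (\<lambda>z. deriv P z / P z) w"
    using nz holP S(1) by (intro higher_deriv_add[OF _ _ S] holomorphic_intros) auto
  also have "(deriv ^^ p) (\<lambda>z. poly (pderiv Q) z) w = 0"
    using Q by (rule higher_deriv_poly_pderiv_eq_0)
  finally have deriv: "(deriv ^^ Suc p) (log_branch f) w =
      of_nat k * (?c / w ^ Suc p) + (deriv ^^ p) (\<lambda>z. deriv P z / P z) w" by simp
  have disj: "Inl ` {..<k} \<inter> Inr ` {m. r m \<noteq> 0} = {}" by auto
  have I: "?I = Inl ` {..<k} \<union> Inr ` {m. r m \<noteq> 0}"
    by (simp add: hadamard_indices_def Plus_def)
  have summR: "G summable_on Inr ` {m. r m \<noteq> 0}"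
    by (rule summable_on_subset_banach[OF summG]) (auto simp: I)
  hence "((\<lambda>m. G (Inr m)) has_sum infsum G (Inr ` {m. r m \<noteq> 0})) {m. r m \<noteq> 0}"
    by (subst (asm) summable_iff_has_sum_infsum) (subst (asm) has_sum_reindex, auto simp: o_def)
  hence "((\<lambda>m. if r m = 0 then 0 else G (Inr m)) has_sum infsum G (Inr ` {m. r m \<noteq> 0})) UNIV"
    by (subst has_sum_cong_neutral[where T = "{m. r m \<noteq> 0}" and g = "\<lambda>m. G (Inr m)"]) auto
  hence "(\<lambda>m. if r m = 0 then 0 else G (Inr m)) sums infsum G (Inr ` {m. r m \<noteq> 0})"
    by (rule has_sum_imp_sums)
  hence "(\<lambda>m. ?c * (if r m = 0 then 0 else G (Inr m))) sums (?c * infsum G (Inr ` {m. r m \<noteq> 0}))"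
    by (rule sums_mult)
  also have "(\<lambda>m. ?c * (if r m = 0 then 0 else G (Inr m))) =
      (\<lambda>m. if r m = 0 then 0 else ?c / (w + of_real (1 / r m)) ^ Suc p)"
    by (auto simp: G_def hadamard_zero_def fun_eq_iff)
  finally have dP: "(deriv ^^ p) (\<lambda>z. deriv P z / P z) w = ?c * infsum G (Inr ` {m. r m \<noteq> 0})"
    using higher_deriv_logderiv_P_sums[OF refl r q w] sums_unique2 by blast
  have "infsum G ?I = infsum G (Inl ` {..<k}) + infsum G (Inr ` {m. r m \<noteq> 0})"
    unfolding I by (rule infsum_Un_disjoint[OF _ summR disj]) (rule summable_on_finite, simp)
  also have "infsum G (Inl ` {..<k}) = (\<Sum>j<k. G (Inl j))"
    by (simp add: infsum_finite sum.reindex)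
  also have "\<dots> = of_nat k / w ^ Suc p"
    by (simp add: G_def hadamard_zero_def)
  finally have "(deriv ^^ Suc p) (log_branch f) w = ?c * infsum G ?I"
    unfolding deriv dP by (simp add: algebra_simps)
  also have "infsum G ?I = (\<Sum>\<^sub>\<infinity>m\<in>indices N. G (\<pi> m))"
    by (rule infsum_reindex_bij_betw[OF \<pi>(1), symmetric])
  also have "\<dots> = (\<Sum>\<^sub>\<infinity>m\<in>indices N. 1 / (w + of_real (lam m)) ^ Suc p)"
    by (rule infsum_cong) (simp add: G_def \<pi>(2))
  finally show "(deriv ^^ Suc p) (log_branch f) w =
           ?c * (\<Sum>\<^sub>\<infinity>m\<in>indices N. 1 / (w + of_real (lam m)) ^ Suc p)" .
qed

section \<open>Integrals over half-lines\<close>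

lemma set_integral_Ioi_FTC_nonneg:
  fixes f F :: "real \<Rightarrow> real"
  assumes F: "\<And>t. t \<ge> a \<Longrightarrow> (F has_real_derivative f t) (at t)"
    and f: "\<And>t. t > a \<Longrightarrow> isCont f t" "\<And>t. t > a \<Longrightarrow> 0 \<le> f t"
    and lim: "(F \<longlongrightarrow> 0) at_top"
  shows "set_integrable lborel {a<..} f" "(LINT t:{a<..}|lborel. f t) = - F a"
proof -
  have lim_a: "(F \<longlongrightarrow> F a) (at_right a)"
    using DERIV_isCont[OF F[of a]] by (auto simp: isCont_def intro: tendsto_within_subset)
  have ae: "AE t in lborel. ereal a < ereal t \<longrightarrow> ereal t < \<infinity> \<longrightarrow> 0 \<le> f t"
    using f(2) by auto
  have lims: "((F \<circ> real_of_ereal) \<longlongrightarrow> F a) (at_right (ereal a))"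
             "((F \<circ> real_of_ereal) \<longlongrightarrow> 0) (at_left \<infinity>)"
    using lim lim_a by (simp_all add: ereal_tendsto_simps1)
  have "set_integrable lborel (einterval (ereal a) \<infinity>) f"
       "(LBINT t=ereal a..\<infinity>. f t) = 0 - F a"
    by (rule interval_integral_FTC_nonneg[OF _ _ _ ae lims]; use F f in simp)+
  thus "set_integrable lborel {a<..} f" "(LINT t:{a<..}|lborel. f t) = - F a"
    by (simp_all add: interval_lebesgue_integral_def)
qed

lemma set_integral_Ioi_FTC:
  fixes f F :: "real \<Rightarrow> complex"
  assumes F: "\<And>t. t \<ge> a \<Longrightarrow> (F has_vector_derivative f t) (at t)"
    and f: "\<And>t. t > a \<Longrightarrow> isCont f t" "set_integrable lborel {a<..} f"
    and lim: "(F \<longlongrightarrow> 0) at_top"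
  shows "(LINT t:{a<..}|lborel. f t) = - F a"
proof -
  have lim_a: "(F \<longlongrightarrow> F a) (at_right a)"
    using has_vector_derivative_continuous[OF F[of a]]
    by (auto simp: isCont_def intro: tendsto_within_subset)
  have lims: "((F \<circ> real_of_ereal) \<longlongrightarrow> F a) (at_right (ereal a))"
             "((F \<circ> real_of_ereal) \<longlongrightarrow> 0) (at_left \<infinity>)"
    using lim lim_a by (simp_all add: ereal_tendsto_simps1)
  have "(LBINT t=ereal a..\<infinity>. f t) = 0 - F a"
    by (rule interval_integral_FTC_integrable[OF _ _ _ _ lims]) (use F f in simp_all)
  thus ?thesis by (simp add: interval_lebesgue_integral_def)
qed

text \<open>The antiderivative of \<open>s ^ n * exp (- s * y)\<close> that vanishes at infinity, obtained by integrating by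
  parts. The type is kept general because both instances are needed: over the reals the integrand is
  nonnegative and the fundamental theorem yields integrability; this dominates the complex
  integrand, whose integral the complex instance evaluates.\<close>

primrec power_exp_antideriv ::
    "nat \<Rightarrow> 'a::{real_normed_field,banach} \<Rightarrow> real \<Rightarrow> 'a" where
  "power_exp_antideriv 0 y s = - exp (- of_real s * y) / y"
| "power_exp_antideriv (Suc n) y s =
     (of_nat (Suc n) * power_exp_antideriv n y s - of_real s ^ Suc n * exp (- of_real s * y)) / y"

lemma power_exp_antideriv_0: "y \<noteq> 0 \<Longrightarrow> power_exp_antideriv n y 0 = - fact n / y ^ Suc n"
proof (induction n)
  case (Suc n)
  show ?case
    using Suc by (simp add: Suc.IH del: of_nat_Suc)
qed simp

lemma has_vector_derivative_power_exp_antideriv: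
  assumes "y \<noteq> 0"
  shows "(power_exp_antideriv n y has_vector_derivative of_real s ^ n * exp (- of_real s * y)) (at s)"
proof (induction n)
  have e: "((\<lambda>s. exp (- of_real s * y)) has_vector_derivative - (y * exp (- of_real s * y))) (at s)"
  proof -
    have "((\<lambda>u. exp (- u * y)) has_field_derivative - (y * exp (- of_real s * y))) (at (of_real s))"
      by (auto intro!: derivative_eq_intros)
    thus ?thesis by (rule has_vector_derivative_real_field)
  qed
  {
    case 0
    have "((\<lambda>s. exp (- of_real s * y) * (- 1 / y)) has_vector_derivative
            - (y * exp (- of_real s * y)) * (- 1 / y)) (at s)"
      by (rule has_vector_derivative_mult_left[OF e])
    thus ?case using assms by (simp add: power_exp_antideriv_def)
  next
    case (Suc n)
    have p: "((\<lambda>s. of_real s ^ Suc n :: 'a) has_vector_derivative of_nat (Suc n) * of_real s ^ n) (at s)"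
    proof -
      have "((\<lambda>u. u ^ Suc n) has_field_derivative of_nat (Suc n) * of_real s ^ n) (at (of_real s :: 'a))"
        by (auto intro!: derivative_eq_intros simp del: power_Suc)
      thus ?thesis by (rule has_vector_derivative_real_field)
    qed
    have "((\<lambda>s. (of_nat (Suc n) * power_exp_antideriv n y s
              - of_real s ^ Suc n * exp (- of_real s * y)) * (1 / y)) has_vector_derivative
            (of_nat (Suc n) * (of_real s ^ n * exp (- of_real s * y))
             - (of_real s ^ Suc n * (- (y * exp (- of_real s * y)))
                + of_nat (Suc n) * of_real s ^ n * exp (- of_real s * y))) * (1 / y)) (at s)"
      by (intro has_vector_derivative_mult_left has_vector_derivative_diff
            has_vector_derivative_mult_right Suc.IH has_vector_derivative_mult p e)
    also have "(of_nat (Suc n) * (of_real s ^ n * exp (- of_real s * y))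
             - (of_real s ^ Suc n * (- (y * exp (- of_real s * y)))
                + of_nat (Suc n) * of_real s ^ n * exp (- of_real s * y))) * (1 / y)
             = of_real s ^ Suc n * exp (- of_real s * y)"
      using assms by (simp add: field_simps)
    finally show ?case by simp
  }
qed

lemma tendsto_power_exp_0:
  fixes x :: real
  assumes "x > 0"
  shows "((\<lambda>s. s ^ n * exp (- s * x)) \<longlongrightarrow> 0) at_top"
proof -
  have "filterlim (\<lambda>s. s * x) at_top at_top"
    by (rule filterlim_at_top_mult_tendsto_pos[OF tendsto_const assms filterlim_ident])
  hence "((\<lambda>s. (s * x) ^ n / exp (s * x)) \<longlongrightarrow> 0) at_top"
    by (rule filterlim_compose[OF tendsto_power_div_exp_0])
  hence "((\<lambda>s. (s * x) ^ n / exp (s * x) * (1 / x ^ n)) \<longlongrightarrow> 0 * (1 / x ^ n)) at_top"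
    by (intro tendsto_intros)
  also have "(\<lambda>s. (s * x) ^ n / exp (s * x) * (1 / x ^ n)) = (\<lambda>s. s ^ n * exp (- s * x))"
    using assms by (simp add: fun_eq_iff power_mult_distrib exp_minus field_simps)
  finally show ?thesis by simp
qed

lemma power_exp_antideriv_tendsto_0:
  fixes y :: "'a::{real_normed_field,banach}"
  assumes "\<And>n. ((\<lambda>s. of_real s ^ n * exp (- of_real s * y)) \<longlongrightarrow> 0) at_top"
  shows "(power_exp_antideriv n y \<longlongrightarrow> 0) at_top"
proof (induction n)
  case 0
  have "((\<lambda>s. - (of_real s ^ 0 * exp (- of_real s * y)) / y) \<longlongrightarrow> - 0 / y) at_top"
    unfolding divide_inverse by (intro tendsto_intros assms)
  thus ?case by (simp add: power_exp_antideriv_def)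
next
  case (Suc n)
  have "((\<lambda>s. (of_nat (Suc n) * power_exp_antideriv n y s
           - of_real s ^ Suc n * exp (- of_real s * y)) / y) \<longlongrightarrow> (of_nat (Suc n) * 0 - 0) / y) at_top"
    unfolding divide_inverse by (intro tendsto_intros assms Suc.IH)
  thus ?case by simp
qed

lemma set_integral_power_exp_real:
  fixes x :: real
  assumes "x > 0"
  shows "set_integrable lborel {0<..} (\<lambda>s. s ^ n * exp (- s * x))"
    and "(LINT s:{0<..}|lborel. s ^ n * exp (- s * x)) = fact n / x ^ Suc n"
proof -
  have D: "(power_exp_antideriv n x has_real_derivative s ^ n * exp (- s * x)) (at s)" for s
    using has_vector_derivative_power_exp_antideriv[of x n s] assms
    by (simp add: has_real_derivative_iff_has_vector_derivative)
  have lim: "(power_exp_antideriv n x \<longlongrightarrow> 0) at_top"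
    using tendsto_power_exp_0[OF assms] by (intro power_exp_antideriv_tendsto_0) simp
  show "set_integrable lborel {0<..} (\<lambda>s. s ^ n * exp (- s * x))"
       "(LINT s:{0<..}|lborel. s ^ n * exp (- s * x)) = fact n / x ^ Suc n"
    using set_integral_Ioi_FTC_nonneg[OF D _ _ lim, of 0] assms
    by (simp_all add: power_exp_antideriv_0)
qed

lemma set_integral_power_exp:
  fixes y :: complex
  assumes "Re y > 0"
  shows "set_integrable lborel {0<..} (\<lambda>s. of_real s ^ n * exp (- of_real s * y))"
    and "(LINT s:{0<..}|lborel. of_real s ^ n * exp (- of_real s * y)) = fact n / y ^ Suc n"
proof -
  show int: "set_integrable lborel {0<..} (\<lambda>s. of_real s ^ n * exp (- of_real s * y))"
    using set_integral_power_exp_real(1)[OF assms, of n]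
    by (rule set_integrable_bound)
       (auto simp: set_borel_measurable_def norm_mult norm_power)
  have y: "y \<noteq> 0" using assms by auto
  have lim: "((\<lambda>s. of_real s ^ n * exp (- of_real s * y)) \<longlongrightarrow> 0) at_top" for n
  proof (rule tendsto_norm_zero_cancel)
    have "eventually (\<lambda>s. s ^ n * exp (- s * Re y) = norm (of_real s ^ n * exp (- of_real s * y))) at_top"
      using eventually_ge_at_top[of 0] by eventually_elim (simp add: norm_mult norm_power)
    thus "((\<lambda>s. norm (of_real s ^ n * exp (- of_real s * y))) \<longlongrightarrow> 0) at_top"
      using tendsto_power_exp_0[OF assms, of n] by (rule Lim_transform_eventually[rotated])
  qed
  have "(LINT s:{0<..}|lborel. of_real s ^ n * exp (- of_real s * y)) = - power_exp_antideriv n y 0"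
    by (rule set_integral_Ioi_FTC[OF has_vector_derivative_power_exp_antideriv[OF y] _ int
          power_exp_antideriv_tendsto_0[OF lim]]) (auto intro!: continuous_intros)
  thus "(LINT s:{0<..}|lborel. of_real s ^ n * exp (- of_real s * y)) = fact n / y ^ Suc n"
    using y by (simp add: power_exp_antideriv_0)
qed

lemma tendsto_recip_power_at_top:
  fixes z :: "'a::real_normed_field"
  shows "((\<lambda>t. c / (z + of_real t) ^ Suc n) \<longlongrightarrow> 0) at_top"
proof -
  have "filterlim (\<lambda>t. z + of_real t) at_infinity at_top"
    by (rule tendsto_add_filterlim_at_infinity[OF tendsto_const filterlim_of_real_at_infinity])
  hence "filterlim (\<lambda>t. (z + of_real t) ^ Suc n) at_infinity at_top"
    by (intro Limits.filterlim_power_at_infinity) simp_all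
  thus ?thesis by (rule tendsto_divide_0[OF tendsto_const])
qed

lemma has_vector_derivative_recip_power:
  fixes z :: "'a::real_normed_field"
  assumes "z + of_real t \<noteq> 0"
  shows "((\<lambda>t. - 1 / of_nat (Suc n) / (z + of_real t) ^ Suc n) has_vector_derivative
           1 / (z + of_real t) ^ (n + 2)) (at t)"
proof -
  define d where "d = z + of_real t"
  have d: "d \<noteq> 0" using assms by (simp add: d_def)
  have "((\<lambda>u. (z + u) ^ Suc n) has_field_derivative of_nat (Suc n) * d ^ n) (at (of_real t))"
    unfolding d_def by (auto intro!: derivative_eq_intros simp del: power_Suc of_nat_Suc)
  from DERIV_cmult[OF DERIV_inverse'[OF this], of "- 1 / of_nat (Suc n)"] d
  have "((\<lambda>u. - 1 / of_nat (Suc n) * inverse ((z + u) ^ Suc n)) has_field_derivative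
          - 1 / of_nat (Suc n) * - (inverse (d ^ Suc n) * (of_nat (Suc n) * d ^ n) * inverse (d ^ Suc n)))
        (at (of_real t))"
    by (simp add: d_def del: of_nat_Suc power_Suc)
  also have "- 1 / of_nat (Suc n) * - (inverse (d ^ Suc n) * (of_nat (Suc n) * d ^ n) * inverse (d ^ Suc n))
       = 1 / d ^ (n + 2)"
  proof -
    have "of_nat (Suc n) \<noteq> (0::'a)" by (rule of_nat_neq_0)
    thus ?thesis using d by (simp add: field_simps del: of_nat_Suc)
  qed
  finally have "((\<lambda>u. - 1 / of_nat (Suc n) / (z + u) ^ Suc n) has_field_derivative
           1 / d ^ (n + 2)) (at (of_real t))"
    by (simp only: divide_inverse mult.assoc)
  thus ?thesis unfolding d_def by (rule has_vector_derivative_real_field)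
qed

lemma set_integral_recip_power_real:
  fixes x :: real
  assumes "x + a > 0"
  shows "set_integrable lborel {a<..} (\<lambda>t. 1 / (x + t) ^ (n + 2))"
    and "(LINT t:{a<..}|lborel. 1 / (x + t) ^ (n + 2)) = 1 / real (Suc n) / (x + a) ^ Suc n"
proof -
  have D: "((\<lambda>t. - 1 / real (Suc n) / (x + t) ^ Suc n) has_real_derivative 1 / (x + t) ^ (n + 2)) (at t)"
    if t: "t \<ge> a" for t
    using has_vector_derivative_recip_power[of x t n] assms t
    by (simp add: has_real_derivative_iff_has_vector_derivative)
  have lim: "((\<lambda>t. - 1 / real (Suc n) / (x + t) ^ Suc n) \<longlongrightarrow> 0) at_top"
    using tendsto_recip_power_at_top[of "- 1 / real (Suc n)" x n] by simp
  have pos: "x + t > 0" if "t > a" for t using assms that by simp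
  have cont: "isCont (\<lambda>t. 1 / (x + t) ^ (n + 2)) t" if "t > a" for t
    using pos[OF that] by (intro continuous_intros) auto
  have nn: "1 / (x + t) ^ (n + 2) \<ge> 0" if "t > a" for t
    using pos[OF that] by simp
  show "set_integrable lborel {a<..} (\<lambda>t. 1 / (x + t) ^ (n + 2))"
       "(LINT t:{a<..}|lborel. 1 / (x + t) ^ (n + 2)) = 1 / real (Suc n) / (x + a) ^ Suc n"
    using set_integral_Ioi_FTC_nonneg[OF D cont nn lim] by simp_all
qed

lemma set_integral_recip_power:
  fixes z :: complex
  assumes "Re z + a > 0"
  shows "set_integrable lborel {a<..} (\<lambda>t. 1 / (z + of_real t) ^ (n + 2))"
    and "(LINT t:{a<..}|lborel. 1 / (z + of_real t) ^ (n + 2)) =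
           1 / of_nat (Suc n) / (z + of_real a) ^ Suc n"
proof -
  have ne: "z + of_real t \<noteq> 0" if "t \<ge> a" for t
  proof
    assume "z + of_real t = 0"
    hence "Re (z + of_real t) = 0" by simp
    thus False using assms that by simp
  qed
  have cont: "isCont (\<lambda>t. 1 / (z + of_real t) ^ (n + 2)) t" if "t > a" for t
    using ne[of t] that by (intro continuous_intros) auto
  show int: "set_integrable lborel {a<..} (\<lambda>t. 1 / (z + of_real t) ^ (n + 2))"
  proof (rule set_integrable_bound[OF set_integral_recip_power_real(1)[OF assms, of n]])
    show "set_borel_measurable lborel {a<..} (\<lambda>t. 1 / (z + of_real t) ^ (n + 2))"
      unfolding set_borel_measurable_def by measurable
    have "norm (1 / (z + of_real t) ^ (n + 2)) \<le> norm (1 / (Re z + t) ^ (n + 2))" if "t > a" for t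
    proof -
      have "Re z + t \<le> norm (z + of_real t)"
        using complex_Re_le_cmod[of "z + of_real t"] by simp
      thus ?thesis using assms that
        unfolding norm_divide norm_power norm_one
        by (intro frac_le power_mono zero_less_power) auto
    qed
    thus "AE t in lborel. t \<in> {a<..} \<longrightarrow> norm (1 / (z + of_real t) ^ (n + 2)) \<le> norm (1 / (Re z + t) ^ (n + 2))"
      by auto
  qed
  show "(LINT t:{a<..}|lborel. 1 / (z + of_real t) ^ (n + 2)) =
           1 / of_nat (Suc n) / (z + of_real a) ^ Suc n"
    using set_integral_Ioi_FTC[OF has_vector_derivative_recip_power[OF ne] cont int
          tendsto_recip_power_at_top] by simp
qed

section \<open>Interchanging sums and integrals\<close>

lemma sums_restrict_of_summable_on:
  fixes B :: "nat \<Rightarrow> 'b::{banach}"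
  assumes "B summable_on I"
  shows "(\<lambda>m. if m \<in> I then B m else 0) sums infsum B I"
proof -
  have "(B has_sum infsum B I) I" using assms by simp
  hence "((\<lambda>m. if m \<in> I then B m else 0) has_sum infsum B I) UNIV"
    by (subst has_sum_cong_neutral[where T = I and g = B]) auto
  thus ?thesis by (rule has_sum_imp_sums)
qed

text \<open>The majorant \<open>B\<close> spares the exact evaluation of the integrals of the norms.\<close>

lemma infsum_set_integral:
  fixes F :: "nat \<Rightarrow> real \<Rightarrow> 'b::{banach, second_countable_topology}"
  assumes int: "\<And>m. m \<in> I \<Longrightarrow> set_integrable lborel A (F m)"
    and bound: "\<And>m. m \<in> I \<Longrightarrow> (LINT t:A|lborel. norm (F m t)) \<le> B m" and B: "B summable_on I"
    and pointwise: "\<And>t. t \<in> A \<Longrightarrow> (\<lambda>m. norm (F m t)) summable_on I"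
  shows "set_integrable lborel A (\<lambda>t. \<Sum>\<^sub>\<infinity>m\<in>I. F m t)"
    and "(LINT t:A|lborel. \<Sum>\<^sub>\<infinity>m\<in>I. F m t) = (\<Sum>\<^sub>\<infinity>m\<in>I. LINT t:A|lborel. F m t)"
proof -
  define f where "f = (\<lambda>m t. if m \<in> I then indicator A t *\<^sub>R F m t else 0)"
  have int_f: "integrable lborel (f m)" for m
    using int[of m] by (cases "m \<in> I") (simp_all add: f_def set_integrable_def)
  have "(\<lambda>m. if m \<in> I then norm (F m t) else 0) sums (\<Sum>\<^sub>\<infinity>m\<in>I. norm (F m t))" if "t \<in> A" for t
    using pointwise[OF that] by (rule sums_restrict_of_summable_on)
  hence "summable (\<lambda>m. if m \<in> I then norm (F m t) else 0)" if "t \<in> A" for t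
    using that sums_summable by blast
  moreover have "(\<lambda>m. norm (f m t)) = (if t \<in> A then (\<lambda>m. if m \<in> I then norm (F m t) else 0) else (\<lambda>_. 0))" for t
    by (auto simp: f_def fun_eq_iff)
  ultimately have summ_f: "summable (\<lambda>m. norm (f m t))" for t
    by simp
  have norm_f: "(LINT t|lborel. norm (f m t)) = (if m \<in> I then LINT t:A|lborel. norm (F m t) else 0)" for m
    by (simp add: f_def set_lebesgue_integral_def)
  have summ_int: "summable (\<lambda>m. LINT t|lborel. norm (f m t))"
  proof (rule summable_comparison_test)
    have "norm (LINT t|lborel. norm (f m t)) \<le> (if m \<in> I then B m else 0)" for m
    proof -
      have "(LINT t|lborel. norm (f m t)) \<ge> 0" by (intro integral_nonneg_AE) auto
      thus ?thesis using bound[of m] norm_f[of m] by simp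
    qed
    thus "\<exists>n0. \<forall>m\<ge>n0. norm (LINT t|lborel. norm (f m t)) \<le> (if m \<in> I then B m else 0)"
      by blast
    show "summable (\<lambda>m. if m \<in> I then B m else 0)"
      using sums_restrict_of_summable_on[OF B] by (rule sums_summable)
  qed
  have sum_f: "(\<Sum>m. f m t) = indicator A t *\<^sub>R (\<Sum>\<^sub>\<infinity>m\<in>I. F m t)" for t
  proof (cases "t \<in> A")
    case True
    have "(\<lambda>m. F m t) summable_on I"
      using pointwise[OF True] by (rule abs_summable_summable)
    hence "(\<lambda>m. if m \<in> I then F m t else 0) sums (\<Sum>\<^sub>\<infinity>m\<in>I. F m t)"
      by (rule sums_restrict_of_summable_on)
    thus ?thesis using True by (simp add: f_def sums_iff cong: if_cong)
  qed (simp add: f_def if_distrib cong: if_cong)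
  have AE: "AE t in lborel. summable (\<lambda>m. norm (f m t))" using summ_f by simp
  show "set_integrable lborel A (\<lambda>t. \<Sum>\<^sub>\<infinity>m\<in>I. F m t)"
    using integrable_suminf[OF int_f AE summ_int] by (simp add: set_integrable_def sum_f)
  have sums: "(\<lambda>m. LINT t|lborel. f m t) sums (LINT t|lborel. (\<Sum>m. f m t))"
    by (rule sums_integral[OF int_f AE summ_int])
  have eq_int: "(LINT t|lborel. f m t) = (if m \<in> I then LINT t:A|lborel. F m t else 0)" for m
    by (simp add: f_def set_lebesgue_integral_def)
  have "(\<lambda>m. LINT t:A|lborel. F m t) summable_on I"
  proof (rule abs_summable_summable, rule summable_on_comparison_test[OF B])
    fix m assume m: "m \<in> I"
    have "norm (LINT t:A|lborel. F m t) \<le> (LINT t:A|lborel. norm (F m t))"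
      unfolding set_lebesgue_integral_def
      using integral_norm_bound[of lborel "\<lambda>t. indicator A t *\<^sub>R F m t"] by simp
    thus "norm (LINT t:A|lborel. F m t) \<le> B m" using bound[OF m] by simp
  qed auto
  from sums_restrict_of_summable_on[OF this] sums
  show "(LINT t:A|lborel. \<Sum>\<^sub>\<infinity>m\<in>I. F m t) = (\<Sum>\<^sub>\<infinity>m\<in>I. LINT t:A|lborel. F m t)"
    unfolding eq_int sum_f by (simp add: set_lebesgue_integral_def sums_unique2)
qed

text \<open>On a strip of finite width a majorant that depends on \<open>s\<close> alone is integrable over the product.\<close>

lemma Fubini_strip:
  fixes k :: "real \<Rightarrow> real \<Rightarrow> 'b::{banach, second_countable_topology}"
  assumes meas[measurable]: "case_prod k \<in> borel_measurable (lborel \<Otimes>\<^sub>M lborel)"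
    and A[measurable]: "A \<in> sets borel" and g: "set_integrable lborel A g"
    and dom: "\<And>s u. s \<in> A \<Longrightarrow> u \<in> {0..c} \<Longrightarrow> norm (k s u) \<le> g s"
  shows "set_integrable lborel A (\<lambda>s. LINT u:{0..c}|lborel. k s u)"
    and "(LINT s:A|lborel. LINT u:{0..c}|lborel. k s u) = (LINT u:{0..c}|lborel. LINT s:A|lborel. k s u)"
proof -
  define f where "f = (\<lambda>s u. indicator A s *\<^sub>R indicator {0..c} u *\<^sub>R k s u)"
  define gA where "gA = (\<lambda>s. indicator A s * g s)"
  define G where "G = (\<lambda>s u. gA s * indicator {0..c} u)"
  have gA: "integrable lborel gA"
    using g by (simp add: set_integrable_def gA_def)
  hence [measurable]: "gA \<in> borel_measurable lborel" by auto
  have [measurable]: "case_prod f \<in> borel_measurable (lborel \<Otimes>\<^sub>M lborel)"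
  proof -
    have "(\<lambda>x. indicator A (fst x) *\<^sub>R indicator {0..c} (snd x) *\<^sub>R case_prod k x)
            \<in> borel_measurable (lborel \<Otimes>\<^sub>M lborel)"
      by measurable
    thus ?thesis by (simp add: f_def case_prod_unfold)
  qed
  have ind: "integrable lborel (\<lambda>u. indicator {0..c} u :: real)"
    by (rule integrable_real_indicator) (auto simp: emeasure_lborel_Icc_eq)
  have G: "integrable (lborel \<Otimes>\<^sub>M lborel) (case_prod G)"
  proof (rule lborel_pair.Fubini_integrable)
    have "(\<lambda>x. gA (fst x) * indicator {0..c} (snd x)) \<in> borel_measurable (lborel \<Otimes>\<^sub>M lborel)"
      by measurable
    thus "case_prod G \<in> borel_measurable (lborel \<Otimes>\<^sub>M lborel)"
      by (simp add: G_def case_prod_unfold)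
    show "integrable lborel (\<lambda>s. LINT u|lborel. norm (case_prod G (s, u)))"
      using integrable_norm[OF gA] by (simp add: G_def abs_mult)
    show "AE s in lborel. integrable lborel (\<lambda>u. case_prod G (s, u))"
      using ind by (simp add: G_def)
  qed
  have f: "integrable (lborel \<Otimes>\<^sub>M lborel) (case_prod f)"
  proof (rule Bochner_Integration.integrable_bound[OF G])
    have "norm (f s u) \<le> norm (G s u)" for s u
      using dom[of s u] by (cases "s \<in> A"; cases "u \<in> {0..c}") (auto simp: f_def G_def gA_def)
    thus "AE x in lborel \<Otimes>\<^sub>M lborel. norm (case_prod f x) \<le> norm (case_prod G x)"
      by auto
  qed simp
  have 1: "(LINT u|lborel. f s u) = indicator A s *\<^sub>R (LINT u:{0..c}|lborel. k s u)" for s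
    unfolding f_def set_lebesgue_integral_def by (rule integral_scaleR_right) 
  have 2: "(LINT s|lborel. f s u) = indicator {0..c} u *\<^sub>R (LINT s:A|lborel. k s u)" for u
    unfolding f_def set_lebesgue_integral_def
    by (subst integral_scaleR_right[symmetric]) (simp add: mult.commute)
  show "set_integrable lborel A (\<lambda>s. LINT u:{0..c}|lborel. k s u)"
    using lborel_pair.integrable_fst[OF f] by (simp add: set_integrable_def 1)
  show "(LINT s:A|lborel. LINT u:{0..c}|lborel. k s u) = (LINT u:{0..c}|lborel. LINT s:A|lborel. k s u)"
    using lborel_pair.Fubini_integral[OF f] unfolding 1 2 by (simp add: set_lebesgue_integral_def)
qed

section \<open>The contribution of one zero and one endpoint\<close>

text \<open>A zero \<open>- \<lambda>\<close> and an endpoint \<open>c\<close> contribute the number \<open>recip_power_integral p c (z + \<lambda>)\<close>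
  to each of the three expressions in the theorem, up to constants. The Laplace integral and the
  Stieltjes integral are brought to this form by writing their kernels
  \<open>(1 - exp (- s * c)) / s\<close> and \<open>ramp c\<close> as integrals over \<open>{0..c}\<close>.\<close>

definition recip_power_integral :: "nat \<Rightarrow> real \<Rightarrow> complex \<Rightarrow> complex" where
  "recip_power_integral p c y = (LINT u:{0..c}|lborel. 1 / (y + of_real u) ^ Suc p)"

definition ramp :: "real \<Rightarrow> real \<Rightarrow> real" where
  "ramp c t = max 0 t - max 0 (t - c)"

lemma exp_integral_Icc:
  fixes s c :: real
  assumes "s > 0" "c \<ge> 0"
  shows "(LINT u:{0..c}|lborel. exp (- of_real (s * u))) = (of_real ((1 - exp (- s * c)) / s) :: complex)"
proof -
  have "(LINT u|lborel. indicator {0..c} u *\<^sub>R exp (- s * u)) = - exp (- s * c) / s - - exp (- s * 0) / s"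
    using assms
    by (intro integral_FTC_atLeastAtMost)
       (auto intro!: derivative_eq_intros continuous_intros simp: has_real_derivative_iff_has_vector_derivative[symmetric])
  hence "(LINT u:{0..c}|lborel. exp (- s * u)) = (1 - exp (- s * c)) / s"
    by (simp add: set_lebesgue_integral_def diff_divide_distrib)
  moreover have "(LINT u:{0..c}|lborel. exp (- of_real (s * u)) :: complex) =
                 of_real (LINT u:{0..c}|lborel. exp (- s * u))"
    by (subst set_integral_complex_of_real[symmetric]) (simp add: exp_of_real[symmetric])
  ultimately show ?thesis by simp
qed

lemma one_minus_exp_quotient_bounds:
  fixes s c :: real
  assumes "s > 0" "c \<ge> 0"
  shows "0 \<le> (1 - exp (- s * c)) / s" "(1 - exp (- s * c)) / s \<le> c"
  using assms exp_ge_add_one_self[of "- s * c"] by (auto simp: field_simps)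

lemma laplace_endpoint:
  fixes y :: complex and c :: real and p :: nat
  assumes y: "Re y > 0" and c: "c \<ge> 0"
  defines "K \<equiv> \<lambda>s. of_real (s ^ p * ((1 - exp (- s * c)) / s)) * exp (- of_real s * y)"
  shows "set_integrable lborel {0<..} K"
    and "(LINT s:{0<..}|lborel. K s) = fact p * recip_power_integral p c y"
    and "(LINT s:{0<..}|lborel. norm (K s)) \<le> c * fact p * (1 / Re y ^ Suc p)"
proof -
  define k where "k = (\<lambda>s u. of_real s ^ p * exp (- of_real s * (y + of_real u)) :: complex)"
  have meas: "case_prod k \<in> borel_measurable (lborel \<Otimes>\<^sub>M lborel)"
  proof -
    have "case_prod k \<in> borel_measurable borel"
      unfolding k_def case_prod_unfold by (intro borel_measurable_continuous_onI continuous_intros)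
    thus ?thesis by (simp add: lborel_prod)
  qed
  have dom: "norm (k s u) \<le> s ^ p * exp (- s * Re y)" if "s \<in> {0<..}" "u \<in> {0..c}" for s u
  proof -
    have "norm (k s u) = s ^ p * exp (- s * (Re y + u))"
      using that by (simp add: k_def norm_mult norm_power)
    also have "\<dots> \<le> s ^ p * exp (- s * Re y)"
      using that by (intro mult_left_mono) (auto simp: distrib_left)
    finally show ?thesis .
  qed
  have inner: "(LINT u:{0..c}|lborel. k s u) = K s" if "s \<in> {0<..}" for s
  proof -
    have "k s u = (of_real s ^ p * exp (- of_real s * y)) * exp (- of_real (s * u))" for u
      by (simp add: k_def distrib_left exp_add exp_diff exp_minus field_simps)
    hence "(LINT u:{0..c}|lborel. k s u) = (of_real s ^ p * exp (- of_real s * y)) *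
             (LINT u:{0..c}|lborel. exp (- of_real (s * u)))"
      by (simp add: set_integral_mult_right)
    also have "(LINT u:{0..c}|lborel. exp (- of_real (s * u))) = (of_real ((1 - exp (- s * c)) / s) :: complex)"
      using that c by (intro exp_integral_Icc) auto
    finally show ?thesis by (simp add: K_def mult_ac)
  qed
  have int0: "set_integrable lborel {0<..} (\<lambda>s. s ^ p * exp (- s * Re y))"
    using y by (rule set_integral_power_exp_real)
  have F: "set_integrable lborel {0<..} (\<lambda>s. LINT u:{0..c}|lborel. k s u)"
    "(LINT s:{0<..}|lborel. LINT u:{0..c}|lborel. k s u) = (LINT u:{0..c}|lborel. LINT s:{0<..}|lborel. k s u)"
    by (rule Fubini_strip[OF meas _ int0 dom]; simp)+
  have "set_integrable lborel {0<..} K \<longleftrightarrow> set_integrable lborel {0<..} (\<lambda>s. LINT u:{0..c}|lborel. k s u)"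
    by (rule set_integrable_cong) (simp_all add: inner)
  thus int: "set_integrable lborel {0<..} K" using F(1) by (rule iffD2)
  have "(LINT s:{0<..}|lborel. K s) = (LINT s:{0<..}|lborel. LINT u:{0..c}|lborel. k s u)"
    by (rule set_lebesgue_integral_cong) (auto simp: inner)
  also have "\<dots> = (LINT u:{0..c}|lborel. LINT s:{0<..}|lborel. k s u)"
    by (rule F(2))
  also have "\<dots> = (LINT u:{0..c}|lborel. fact p * (1 / (y + of_real u) ^ Suc p))"
  proof (rule set_lebesgue_integral_cong)
    show "\<forall>u. u \<in> {0..c} \<longrightarrow> (LINT s:{0<..}|lborel. k s u) = fact p * (1 / (y + of_real u) ^ Suc p)"
      using set_integral_power_exp(2)[of "y + of_real u" p for u] y by (auto simp: k_def)
  qed auto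
  finally show "(LINT s:{0<..}|lborel. K s) = fact p * recip_power_integral p c y"
    by (simp only: set_integral_mult_right recip_power_integral_def)
  have "(LINT s:{0<..}|lborel. norm (K s)) \<le> (LINT s:{0<..}|lborel. c * (s ^ p * exp (- s * Re y)))"
  proof (rule set_integral_mono)
    show "set_integrable lborel {0<..} (\<lambda>s. norm (K s))"
      using int by (rule set_integrable_norm)
    show "set_integrable lborel {0<..} (\<lambda>s. c * (s ^ p * exp (- s * Re y)))"
      using int0 by (rule set_integrable_mult_right)
    show "norm (K s) \<le> c * (s ^ p * exp (- s * Re y))" if "s \<in> {0<..}" for s
    proof -
      have s: "s > 0" using that by simp
      have nn: "0 \<le> s ^ p * ((1 - exp (- s * c)) / s)"
        using one_minus_exp_quotient_bounds(1)[OF s c] s by (intro mult_nonneg_nonneg) auto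
      have "norm (K s) = s ^ p * ((1 - exp (- s * c)) / s) * exp (- s * Re y)"
        unfolding K_def norm_mult norm_of_real abs_of_nonneg[OF nn] by simp
      also have "\<dots> \<le> s ^ p * c * exp (- s * Re y)"
        using one_minus_exp_quotient_bounds[OF s c] s by (intro mult_right_mono mult_left_mono) auto
      finally show ?thesis by (simp add: mult_ac)
    qed
  qed
  also have "\<dots> = c * fact p * (1 / Re y ^ Suc p)"
    using set_integral_power_exp_real(2)[OF y, of p] by (simp add: set_integral_mult_right)
  finally show "(LINT s:{0<..}|lborel. norm (K s)) \<le> c * fact p * (1 / Re y ^ Suc p)" .
qed

lemma ramp_bounds: "c \<ge> 0 \<Longrightarrow> 0 \<le> ramp c t" "c \<ge> 0 \<Longrightarrow> ramp c t \<le> c"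
  and ramp_nonpos: "c \<ge> 0 \<Longrightarrow> t \<le> 0 \<Longrightarrow> ramp c t = 0"
  by (auto simp: ramp_def)

lemma ramp_eq_integral:
  assumes "c \<ge> 0"
  shows "(LINT u:{0..c}|lborel. indicator {u<..} t) = ramp c t"
proof -
  have "(LINT u:{0..c}|lborel. indicator {u<..} t) = (LINT u|lborel. indicator ({0..c} \<inter> {..<t}) u :: real)"
    unfolding set_lebesgue_integral_def
    by (intro Bochner_Integration.integral_cong) (auto simp: indicator_def)
  also have "\<dots> = measure lborel ({0..c} \<inter> {..<t})"
    by simp
  also have "{0..c} \<inter> {..<t} = (if t \<le> 0 then {} else if t \<le> c then {0..<t} else {0..c})"
    by auto
  also have "measure lborel \<dots> = ramp c t"
    using assms by (auto simp: ramp_def)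
  finally show ?thesis .
qed

lemma stieltjes_endpoint:
  fixes z :: complex and l c :: real and p :: nat
  assumes z: "Re z > 0" and l: "l \<ge> 0" and c: "c \<ge> 0"
  defines "K \<equiv> \<lambda>t. of_real (ramp c (t - l)) / (z + of_real t) ^ (p + 2)"
  shows "set_integrable lborel {0<..} K"
    and "(LINT t:{0<..}|lborel. K t) = 1 / of_nat (Suc p) * recip_power_integral p c (z + of_real l)"
    and "(LINT t:{0<..}|lborel. norm (K t)) \<le> c / real (Suc p) * (1 / (Re z + l) ^ Suc p)"
proof -
  define k where "k = (\<lambda>t u. of_real (indicator {u<..} (t - l)) / (z + of_real t) ^ (p + 2) :: complex)"
  have meas: "case_prod k \<in> borel_measurable (lborel \<Otimes>\<^sub>M lborel)"
  proof -
    have eq: "case_prod k = (\<lambda>x. of_real (indicator {x. snd x < fst x - l} x) / (z + of_real (fst x)) ^ (p + 2))"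
      by (auto simp: k_def fun_eq_iff indicator_def)
    have "open {x :: real \<times> real. snd x < fst x - l}"
      by (intro open_Collect_less continuous_intros)
    hence [measurable]: "{x :: real \<times> real. snd x < fst x - l} \<in> sets borel" by simp
    have cont: "continuous_on UNIV (\<lambda>x :: real \<times> real. z + of_real (fst x))"
      by (intro continuous_intros)
    have "case_prod k \<in> borel_measurable borel"
      unfolding eq
      by (intro borel_measurable_divide borel_measurable_power borel_measurable_of_real
            borel_measurable_indicator borel_measurable_continuous_onI[OF cont]) measurable
    thus ?thesis by (simp add: lborel_prod)
  qed
  have norm_le: "norm (1 / (z + of_real t) ^ (p + 2)) \<le> 1 / (Re z + t) ^ (p + 2)" if "t > 0" for t
    by (intro norm_recip_power_shift_le) (use z that in auto)
  have dom: "norm (k t u) \<le> 1 / (Re z + t) ^ (p + 2)" if "t \<in> {0<..}" "u \<in> {0..c}" for t u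
    using norm_le[of t] that z by (cases "u < t - l") (auto simp: k_def)
  have inner: "(LINT u:{0..c}|lborel. k t u) = K t" for t
  proof -
    have "(LINT u:{0..c}|lborel. k t u) =
          (LINT u:{0..c}|lborel. of_real (indicator {u<..} (t - l))) / (z + of_real t) ^ (p + 2)"
      unfolding k_def by (rule set_integral_divide_zero)
    also have "(LINT u:{0..c}|lborel. of_real (indicator {u<..} (t - l)) :: complex) = of_real (ramp c (t - l))"
      unfolding ramp_eq_integral[OF c, symmetric] by (rule set_integral_complex_of_real)
    finally show ?thesis by (simp add: K_def)
  qed
  have int0: "set_integrable lborel {a<..} (\<lambda>t. 1 / (Re z + t) ^ (p + 2))" if "a \<ge> 0" for a
    using z that by (intro set_integral_recip_power_real(1)) auto
  have F: "set_integrable lborel {0<..} (\<lambda>t. LINT u:{0..c}|lborel. k t u)"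
    "(LINT t:{0<..}|lborel. LINT u:{0..c}|lborel. k t u) = (LINT u:{0..c}|lborel. LINT t:{0<..}|lborel. k t u)"
    by (rule Fubini_strip[OF meas _ int0[OF order_refl] dom]; simp)+
  show int: "set_integrable lborel {0<..} K"
    using F(1) by (simp add: inner)
  have "(LINT t:{0<..}|lborel. K t) = (LINT t:{0<..}|lborel. LINT u:{0..c}|lborel. k t u)"
    by (simp add: inner)
  also have "\<dots> = (LINT u:{0..c}|lborel. LINT t:{0<..}|lborel. k t u)"
    by (rule F(2))
  also have "\<dots> = (LINT u:{0..c}|lborel. 1 / of_nat (Suc p) * (1 / (z + of_real l + of_real u) ^ Suc p))"
  proof (rule set_lebesgue_integral_cong)
    show "\<forall>u. u \<in> {0..c} \<longrightarrow> (LINT t:{0<..}|lborel. k t u) =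
             1 / of_nat (Suc p) * (1 / (z + of_real l + of_real u) ^ Suc p)"
    proof (intro allI impI)
      fix u assume u: "u \<in> {0..c}"
      have "(LINT t:{0<..}|lborel. k t u) = (LINT t:{l + u<..}|lborel. 1 / (z + of_real t) ^ (p + 2))"
        unfolding set_lebesgue_integral_def
        by (intro Bochner_Integration.integral_cong) (use u l in \<open>auto simp: k_def indicator_def\<close>)
      also have "\<dots> = 1 / of_nat (Suc p) / (z + of_real (l + u)) ^ Suc p"
        using z l u by (intro set_integral_recip_power(2)) auto
      finally show "(LINT t:{0<..}|lborel. k t u) =
             1 / of_nat (Suc p) * (1 / (z + of_real l + of_real u) ^ Suc p)"
        by (simp add: add.assoc)
    qed
  qed auto
  finally show "(LINT t:{0<..}|lborel. K t) = 1 / of_nat (Suc p) * recip_power_integral p c (z + of_real l)"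
    by (simp only: set_integral_mult_right recip_power_integral_def)
  have norm_K: "norm (K t) \<le> c * (indicator {l<..} t * (1 / (Re z + t) ^ (p + 2)))" if "t > 0" for t
  proof (cases "t > l")
    case True
    have "norm (K t) = ramp c (t - l) * norm (1 / (z + of_real t) ^ (p + 2))"
      using ramp_bounds(1)[OF c] by (simp add: K_def norm_divide)
    also have "\<dots> \<le> c * (1 / (Re z + t) ^ (p + 2))"
      using ramp_bounds[OF c] c norm_le[OF that] by (intro mult_mono) auto
    finally show ?thesis using True by simp
  qed (simp add: K_def ramp_nonpos[OF c])
  have "(LINT t:{0<..}|lborel. norm (K t)) \<le>
        (LINT t:{0<..}|lborel. c * (indicator {l<..} t * (1 / (Re z + t) ^ (p + 2))))"
  proof (rule set_integral_mono)
    show "set_integrable lborel {0<..} (\<lambda>t. norm (K t))"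
      using int by (rule set_integrable_norm)
    have "(\<lambda>t. indicator {0<..} t *\<^sub>R (indicator {l<..} t * (1 / (Re z + t) ^ (p + 2)))) =
          (\<lambda>t. indicator {l<..} t *\<^sub>R (1 / (Re z + t) ^ (p + 2)))"
      using l by (auto simp: indicator_def)
    hence "set_integrable lborel {0<..} (\<lambda>t. indicator {l<..} t * (1 / (Re z + t) ^ (p + 2)))"
      using int0[OF l] unfolding set_integrable_def by simp
    thus "set_integrable lborel {0<..} (\<lambda>t. c * (indicator {l<..} t * (1 / (Re z + t) ^ (p + 2))))"
      by (rule set_integrable_mult_right)
  qed (use norm_K in auto)
  also have "\<dots> = (LINT t:{l<..}|lborel. c * (1 / (Re z + t) ^ (p + 2)))"
    unfolding set_lebesgue_integral_def
    by (intro Bochner_Integration.integral_cong) (use l in \<open>auto simp: indicator_def\<close>)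
  also have "\<dots> = c * (1 / real (Suc p) / (Re z + l) ^ Suc p)"
    unfolding set_integral_mult_right
    using set_integral_recip_power_real(2)[of "Re z" l p] z l by simp
  finally show "(LINT t:{0<..}|lborel. norm (K t)) \<le> c / real (Suc p) * (1 / (Re z + l) ^ Suc p)"
    by simp
qed

section \<open>Summation over the zeros\<close>

lemma norm_recip_power_segment_le:
  assumes "Re y > 0" "c \<ge> 0" "u \<in> {0..c}"
  shows "norm (1 / (y + of_real u) ^ Suc p) \<le> 1 / Re y ^ Suc p"
proof -
  have "norm (1 / (y + of_real u) ^ Suc p) \<le> 1 / (Re y + u) ^ Suc p"
    using assms by (intro norm_recip_power_shift_le) auto
  also have "\<dots> \<le> 1 / Re y ^ Suc p"
    using assms by (intro divide_left_mono power_mono mult_pos_pos zero_less_power) auto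
  finally show ?thesis .
qed

locale summable_zeros =
  fixes p :: nat and I :: "nat set" and lam :: "nat \<Rightarrow> real"
  assumes lam_nonneg: "m \<in> I \<Longrightarrow> 0 \<le> lam m"
    and summable_shift: "x > 0 \<Longrightarrow> (\<lambda>m. 1 / (x + lam m) ^ Suc p) summable_on I"
begin

definition zero_sum :: "real \<Rightarrow> complex \<Rightarrow> complex" where
  "zero_sum c z = (\<Sum>\<^sub>\<infinity>m\<in>I. recip_power_integral p c (z + of_real (lam m)))"

text \<open>The estimate \<open>(1 + x / n) ^ n \<le> exp x\<close> with \<open>n = Suc p\<close> bounds \<open>exp (- lam m * s)\<close> by a multiple of
  \<open>1 / (n / s + lam m) ^ n\<close>.\<close>

lemma summable_exp:
  assumes "s > 0"
  shows "(\<lambda>m. exp (- lam m * s)) summable_on I"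
proof -
  let ?n = "Suc p" and ?x = "real (Suc p) / s"
  have x: "?x > 0" using assms by simp
  have "(\<lambda>m. ?x ^ ?n * (1 / (?x + lam m) ^ ?n)) summable_on I"
    using summable_shift[OF x] by (rule summable_on_cmult_right)
  thus ?thesis
  proof (rule summable_on_comparison_test)
    fix m assume m: "m \<in> I"
    have nn: "0 \<le> lam m * s" using lam_nonneg[OF m] assms by simp
    have "(1 + lam m * s / real ?n) ^ ?n \<le> exp (lam m * s)"
      using nn by (intro exp_ge_one_plus_x_over_n_power_n) auto
    moreover have pos: "0 < (1 + lam m * s / real ?n) ^ ?n"
      using nn by (intro zero_less_power add_pos_nonneg divide_nonneg_nonneg) auto
    ultimately have "1 / exp (lam m * s) \<le> 1 / (1 + lam m * s / real ?n) ^ ?n"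
      by (intro divide_left_mono mult_pos_pos) auto
    also have "1 + lam m * s / real ?n = (?x + lam m) / ?x"
      using assms x by (simp add: field_simps del: of_nat_Suc)
    also have "1 / ((?x + lam m) / ?x) ^ ?n = ?x ^ ?n * (1 / (?x + lam m) ^ ?n)"
      unfolding power_divide by simp
    finally show "exp (- lam m * s) \<le> ?x ^ ?n * (1 / (?x + lam m) ^ ?n)"
      by (simp add: exp_minus field_simps del: power_Suc of_nat_Suc)
  qed simp
qed

lemma finite_le: "finite {m\<in>I. lam m \<le> t}"
proof (cases "t \<ge> 0")
  case True
  let ?e = "1 / (1 + t) ^ Suc p"
  have "(\<lambda>m. if m \<in> I then 1 / (1 + lam m) ^ Suc p else 0) \<longlonglongrightarrow> 0"
    using sums_restrict_of_summable_on[OF summable_shift[of 1]] sums_summable summable_LIMSEQ_zero by force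
  moreover have "?e > 0" using True by simp
  ultimately have "eventually (\<lambda>m. (if m \<in> I then 1 / (1 + lam m) ^ Suc p else 0) < ?e) sequentially"
    by (rule order_tendstoD(2))
  then obtain n0 where n0: "\<And>m. m \<ge> n0 \<Longrightarrow> (if m \<in> I then 1 / (1 + lam m) ^ Suc p else 0) < ?e"
    by (auto simp: eventually_sequentially)
  have "m < n0" if "m \<in> I" "lam m \<le> t" for m
  proof (rule ccontr)
    assume "\<not> m < n0"
    hence "1 / (1 + lam m) ^ Suc p < ?e" using n0[of m] that by simp
    moreover have "?e \<le> 1 / (1 + lam m) ^ Suc p"
      using that lam_nonneg[OF that(1)] by (intro frac_le power_mono zero_less_power) auto
    ultimately show False by linarith
  qed
  hence "{m\<in>I. lam m \<le> t} \<subseteq> {..<n0}" by auto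
  thus ?thesis by (rule finite_subset) simp
next
  case False
  hence "{m\<in>I. lam m \<le> t} = {}" using lam_nonneg by force
  thus ?thesis by (simp only: finite.emptyI)
qed

lemma infsum_shift_finite:
  fixes r :: "real \<Rightarrow> real"
  assumes "\<And>t. t \<le> 0 \<Longrightarrow> r t = 0"
  shows "(\<lambda>m. r (t - lam m)) summable_on I"
    and "(\<Sum>\<^sub>\<infinity>m\<in>I. r (t - lam m)) = (\<Sum>m\<in>{m\<in>I. lam m \<le> t}. r (t - lam m))"
proof -
  let ?S = "{m\<in>I. lam m \<le> t}"
  have z: "r (t - lam m) = 0" if "m \<in> I - ?S" for m
    using that by (intro assms) auto
  have "((\<lambda>m. r (t - lam m)) has_sum (\<Sum>m\<in>?S. r (t - lam m))) ?S"
    by (rule has_sum_finite[OF finite_le])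
  hence "((\<lambda>m. r (t - lam m)) has_sum (\<Sum>m\<in>?S. r (t - lam m))) I"
    by (subst has_sum_cong_neutral[where T = ?S and g = "\<lambda>m. r (t - lam m)"]) (use z in auto)
  thus "(\<lambda>m. r (t - lam m)) summable_on I"
    and "(\<Sum>\<^sub>\<infinity>m\<in>I. r (t - lam m)) = (\<Sum>m\<in>?S. r (t - lam m))"
    by (auto simp: summable_on_def infsumI)
qed

lemma Re_shift: "Re z > 0 \<Longrightarrow> m \<in> I \<Longrightarrow> Re (z + of_real (lam m)) > 0"
  using lam_nonneg[of m] by simp

lemma laplace_sum:
  assumes z: "Re z > 0" and c: "c \<ge> 0"
  defines "J \<equiv> \<lambda>s. exp (- of_real s * z) *
             of_real (s ^ p * ((1 - exp (- s * c)) / s) * (\<Sum>\<^sub>\<infinity>m\<in>I. exp (- lam m * s)))"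
  shows "set_integrable lborel {0<..} J"
    and "(LINT s:{0<..}|lborel. J s) = fact p * zero_sum c z"
proof -
  define F where "F = (\<lambda>m s. of_real (s ^ p * ((1 - exp (- s * c)) / s)) *
                              exp (- of_real s * (z + of_real (lam m))) :: complex)"
  have F: "F m s = (exp (- of_real s * z) * of_real (s ^ p * ((1 - exp (- s * c)) / s))) *
             of_real (exp (- lam m * s))" for m s
    by (simp add: F_def distrib_left exp_add exp_diff exp_minus exp_of_real[symmetric] field_simps)
  have int: "set_integrable lborel {0<..} (F m)"
    "(LINT s:{0<..}|lborel. F m s) = fact p * recip_power_integral p c (z + of_real (lam m))"
    "(LINT s:{0<..}|lborel. norm (F m s)) \<le> c * fact p * (1 / (Re z + lam m) ^ Suc p)" if "m \<in> I" for m
    using laplace_endpoint[OF Re_shift[OF z that] c, of p] by (simp_all add: F_def)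
  have summ: "(\<lambda>m. c * fact p * (1 / (Re z + lam m) ^ Suc p)) summable_on I"
    by (intro summable_on_cmult_right summable_shift z)
  have pt: "(\<lambda>m. norm (F m s)) summable_on I" if "s \<in> {0<..}" for s
  proof -
    have "norm (F m s) = norm (exp (- of_real s * z) * of_real (s ^ p * ((1 - exp (- s * c)) / s))) *
             exp (- lam m * s)" for m
      unfolding F norm_mult by simp
    thus ?thesis using summable_exp[of s] that by (simp only: greaterThan_iff summable_on_cmult_right)
  qed
  have sumF: "(\<Sum>\<^sub>\<infinity>m\<in>I. F m s) = J s" if "s \<in> {0<..}" for s
  proof -
    have "(\<Sum>\<^sub>\<infinity>m\<in>I. F m s) = (exp (- of_real s * z) * of_real (s ^ p * ((1 - exp (- s * c)) / s))) *
             (\<Sum>\<^sub>\<infinity>m\<in>I. of_real (exp (- lam m * s)))"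
      unfolding F by (rule infsum_cmult_right')
    also have "(\<Sum>\<^sub>\<infinity>m\<in>I. of_real (exp (- lam m * s)) :: complex) = of_real (\<Sum>\<^sub>\<infinity>m\<in>I. exp (- lam m * s))"
      using summable_exp[of s] that
      by (intro infsumI[OF has_sum_of_real[OF has_sum_infsum]]) simp
    finally show ?thesis by (simp add: J_def mult_ac)
  qed
  note E = infsum_set_integral[OF int(1) int(3) summ pt]
  have "set_integrable lborel {0<..} J \<longleftrightarrow> set_integrable lborel {0<..} (\<lambda>s. \<Sum>\<^sub>\<infinity>m\<in>I. F m s)"
    by (rule set_integrable_cong) (simp_all add: sumF)
  thus "set_integrable lborel {0<..} J" using E(1) by blast
  have "(LINT s:{0<..}|lborel. J s) = (LINT s:{0<..}|lborel. \<Sum>\<^sub>\<infinity>m\<in>I. F m s)"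
    by (rule set_lebesgue_integral_cong) (auto simp: sumF)
  also have "\<dots> = (\<Sum>\<^sub>\<infinity>m\<in>I. LINT s:{0<..}|lborel. F m s)"
    by (rule E(2)) auto
  also have "\<dots> = (\<Sum>\<^sub>\<infinity>m\<in>I. fact p * recip_power_integral p c (z + of_real (lam m)))"
    by (rule infsum_cong) (rule int(2))
  finally show "(LINT s:{0<..}|lborel. J s) = fact p * zero_sum c z"
    by (simp add: zero_sum_def infsum_cmult_right')
qed

lemma stieltjes_sum:
  assumes z: "Re z > 0" and c: "c \<ge> 0"
  defines "J \<equiv> \<lambda>t. of_real (\<Sum>\<^sub>\<infinity>m\<in>I. ramp c (t - lam m)) / (z + of_real t) ^ (p + 2)"
  shows "set_integrable lborel {0<..} J"
    and "(LINT t:{0<..}|lborel. J t) = 1 / of_nat (Suc p) * zero_sum c z"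
proof -
  define F where "F = (\<lambda>m t. of_real (ramp c (t - lam m)) / (z + of_real t) ^ (p + 2))"
  have int: "set_integrable lborel {0<..} (F m)"
    "(LINT t:{0<..}|lborel. F m t) = 1 / of_nat (Suc p) * recip_power_integral p c (z + of_real (lam m))"
    "(LINT t:{0<..}|lborel. norm (F m t)) \<le> c / real (Suc p) * (1 / (Re z + lam m) ^ Suc p)" if "m \<in> I" for m
    using stieltjes_endpoint[OF z lam_nonneg[OF that] c, of p] unfolding F_def by blast+
  have summ: "(\<lambda>m. c / real (Suc p) * (1 / (Re z + lam m) ^ Suc p)) summable_on I"
    by (intro summable_on_cmult_right summable_shift z)
  have ramp: "(\<lambda>m. ramp c (t - lam m)) summable_on I" for t
    by (rule infsum_shift_finite) (rule ramp_nonpos[OF c])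
  have pt: "(\<lambda>m. norm (F m t)) summable_on I" for t
  proof -
    have "norm (F m t) = ramp c (t - lam m) * (1 / norm (z + of_real t) ^ (p + 2))" for m
      unfolding F_def norm_divide norm_power norm_of_real using ramp_bounds(1)[OF c] by simp
    thus ?thesis using ramp[of t] by (simp only: summable_on_cmult_left)
  qed
  have sumF: "(\<Sum>\<^sub>\<infinity>m\<in>I. F m t) = J t" for t
  proof -
    have "(\<Sum>\<^sub>\<infinity>m\<in>I. F m t) = (\<Sum>\<^sub>\<infinity>m\<in>I. of_real (ramp c (t - lam m)) * (1 / (z + of_real t) ^ (p + 2)))"
      by (simp add: F_def)
    also have "\<dots> = (\<Sum>\<^sub>\<infinity>m\<in>I. of_real (ramp c (t - lam m))) * (1 / (z + of_real t) ^ (p + 2))"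
      by (rule infsum_cmult_left')
    also have "(\<Sum>\<^sub>\<infinity>m\<in>I. of_real (ramp c (t - lam m)) :: complex) = of_real (\<Sum>\<^sub>\<infinity>m\<in>I. ramp c (t - lam m))"
      by (rule infsumI[OF has_sum_of_real[OF has_sum_infsum[OF ramp]]])
    finally show ?thesis by (simp add: J_def)
  qed
  note E = infsum_set_integral[OF int(1) int(3) summ pt]
  show "set_integrable lborel {0<..} J"
    using E(1) by (simp add: sumF)
  have "(LINT t:{0<..}|lborel. J t) = (\<Sum>\<^sub>\<infinity>m\<in>I. LINT t:{0<..}|lborel. F m t)"
    using E(2) by (simp add: sumF)
  also have "\<dots> = (\<Sum>\<^sub>\<infinity>m\<in>I. 1 / of_nat (Suc p) * recip_power_integral p c (z + of_real (lam m)))"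
    by (rule infsum_cong) (rule int(2))
  finally show "(LINT t:{0<..}|lborel. J t) = 1 / of_nat (Suc p) * zero_sum c z"
    unfolding zero_sum_def infsum_cmult_right' .
qed

text \<open>Integrate the derivative of order \<open>Suc p\<close> along the segment from \<open>z\<close> to \<open>z + c\<close> and interchange the
  integral with the sum over the zeros.\<close>

lemma deriv_difference_eq_zero_sum:
  assumes z: "Re z > 0" and c: "c \<ge> 0" and L: "L holomorphic_on {w. Re w > 0}"
    and deriv: "\<And>w. Re w > 0 \<Longrightarrow>
          (deriv ^^ Suc p) L w = C * (\<Sum>\<^sub>\<infinity>m\<in>I. 1 / (w + of_real (lam m)) ^ Suc p)"
  shows "(deriv ^^ p) L (z + of_real c) - (deriv ^^ p) L z = C * zero_sum c z"
proof -
  let ?H = "{w. Re w > 0}"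
  have H: "open ?H" by (simp add: open_halfspace_Re_gt)
  have hol: "(deriv ^^ n) L holomorphic_on ?H" for n
    using L H by (rule holomorphic_higher_deriv)
  have inH: "z + of_real u \<in> ?H" if "u \<in> {0..c}" for u
    using z that by simp
  define F where "F = (\<lambda>m u. 1 / (z + of_real (lam m) + of_real u) ^ Suc p)"
  have bound: "norm (F m u) \<le> 1 / (Re z + lam m) ^ Suc p" if "m \<in> I" "u \<in> {0..c}" for m u
    using norm_recip_power_segment_le[OF Re_shift[OF z that(1)] c that(2), of p] by (simp add: F_def)
  have const: "set_integrable lborel {0..c} (\<lambda>_. B)" for B :: real
    by (intro borel_integrable_atLeastAtMost' continuous_intros)
  have int: "set_integrable lborel {0..c} (F m)" if "m \<in> I" for m
  proof -
    have "z + of_real (lam m) + of_real u \<noteq> 0" if "u \<in> {0..c}" for u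
    proof
      assume "z + of_real (lam m) + of_real u = 0"
      hence "Re (z + of_real (lam m) + of_real u) = 0" by simp
      thus False using Re_shift[OF z \<open>m \<in> I\<close>] that by simp
    qed
    hence "continuous_on {0..c} (F m)"
      unfolding F_def by (intro continuous_intros) auto
    thus ?thesis by (intro borel_integrable_atLeastAtMost') 
  qed
  have norm_int: "(LINT u:{0..c}|lborel. norm (F m u)) \<le> c * (1 / (Re z + lam m) ^ Suc p)" if "m \<in> I" for m
  proof -
    have "(LINT u:{0..c}|lborel. norm (F m u)) \<le> (LINT u:{0..c}|lborel. 1 / (Re z + lam m) ^ Suc p)"
      by (intro set_integral_mono set_integrable_norm int const bound that)
    also have "\<dots> = c * (1 / (Re z + lam m) ^ Suc p)"
      using c by (simp add: set_lebesgue_integral_def)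
    finally show ?thesis .
  qed
  have summ: "(\<lambda>m. c * (1 / (Re z + lam m) ^ Suc p)) summable_on I"
    by (intro summable_on_cmult_right summable_shift z)
  have pt: "(\<lambda>m. norm (F m u)) summable_on I" if "u \<in> {0..c}" for u
    using summable_shift[OF z] by (rule summable_on_comparison_test) (use bound that in auto)
  have "(deriv ^^ p) L (z + of_real c) - (deriv ^^ p) L (z + of_real 0) =
        (LINT u|lborel. indicator {0..c} u *\<^sub>R (deriv ^^ Suc p) L (z + of_real u))"
  proof (rule integral_FTC_atLeastAtMost[OF c, symmetric])
    fix u assume u: "0 \<le> u" "u \<le> c"
    have D: "((deriv ^^ p) L has_field_derivative (deriv ^^ Suc p) L (z + of_real u)) (at (z + of_real u))"
      using holomorphic_derivI[OF hol H inH, of u p UNIV] u by simp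
    have "((\<lambda>w. (deriv ^^ p) L (z + w)) has_field_derivative (deriv ^^ Suc p) L (z + of_real u)) (at (of_real u))"
      using D DERIV_shift[of "(deriv ^^ p) L" "(deriv ^^ Suc p) L (z + of_real u)" "of_real u" z]
      by (simp only: add.commute)
    thus "((\<lambda>u. (deriv ^^ p) L (z + of_real u)) has_vector_derivative (deriv ^^ Suc p) L (z + of_real u))
            (at u within {0..c})"
      by (rule has_vector_derivative_at_within[OF has_vector_derivative_real_field])
  next
    show "continuous_on {0..c} (\<lambda>u. (deriv ^^ Suc p) L (z + of_real u))"
      using inH by (intro continuous_on_compose2[OF holomorphic_on_imp_continuous_on[OF hol]] continuous_intros) auto
  qed
  also have "\<dots> = (LINT u:{0..c}|lborel. C * (\<Sum>\<^sub>\<infinity>m\<in>I. F m u))"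
    unfolding set_lebesgue_integral_def
  proof (rule Bochner_Integration.integral_cong[OF refl])
    fix u
    have "(deriv ^^ Suc p) L (z + of_real u) = C * (\<Sum>\<^sub>\<infinity>m\<in>I. F m u)" if "u \<in> {0..c}"
      using deriv[of "z + of_real u"] inH[OF that] by (simp only: mem_Collect_eq F_def add_ac)
    thus "indicator {0..c} u *\<^sub>R (deriv ^^ Suc p) L (z + of_real u) =
          indicator {0..c} u *\<^sub>R (C * (\<Sum>\<^sub>\<infinity>m\<in>I. F m u))"
      by (auto simp: indicator_def simp del: funpow.simps)
  qed
  also have "\<dots> = C * (LINT u:{0..c}|lborel. \<Sum>\<^sub>\<infinity>m\<in>I. F m u)"
    by (rule set_integral_mult_right)
  also have "(LINT u:{0..c}|lborel. \<Sum>\<^sub>\<infinity>m\<in>I. F m u) = (\<Sum>\<^sub>\<infinity>m\<in>I. LINT u:{0..c}|lborel. F m u)"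
    by (rule infsum_set_integral(2)[OF int norm_int summ pt])
  finally show ?thesis
    by (simp add: zero_sum_def recip_power_integral_def F_def)
qed

end

section \<open>The logarithmic quotient\<close>

lemma rho_fun_eq_ramps: "rho_fun n a b t = (\<Sum>k=1..n. ramp (b k) t - ramp (a k) t)"
proof -
  have "(t - c) * indicator {c..} t = max 0 t - ramp c t" for c
    by (auto simp: ramp_def indicator_def)
  thus ?thesis by (simp add: rho_fun_def sum_subtractf[symmetric])
qed

lemma g_fun_eq:
  assumes "s > 0"
  shows "s * g_fun n a b s =
           (\<Sum>k=1..n. (1 - exp (- s * b k)) / s - (1 - exp (- s * a k)) / s)"
proof -
  have "s * g_fun n a b s = (\<Sum>k=1..n. (exp (- s * a k) - exp (- s * b k)) / s)"
  proof -
    have "s * (1 / s\<^sup>2 * X) = X / s" for X :: real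
      using assms by (simp add: power2_eq_square)
    thus ?thesis by (simp only: g_fun_def sum_divide_distrib)
  qed
  also have "\<dots> = (\<Sum>k=1..n. (1 - exp (- s * b k)) / s - (1 - exp (- s * a k)) / s)"
    by (intro sum.cong) (simp_all add: diff_divide_distrib)
  finally show ?thesis .
qed

text \<open>Cut the list \<open>b\<close> at the largest index with \<open>b k \<le> t\<close>: up to there
  \<open>max 0 (t - b k) = t - b k\<close>, and the partial sums can be compared.\<close>

lemma rho_fun_nonneg:
  assumes maj: "weak_supermaj n b a" and b: "mono_on {1..n} b"
  shows "rho_fun n a b t \<ge> 0"
proof -
  have eq: "(t - c) * indicator {c..} t = max 0 (t - c)" for c
    by (auto simp: indicator_def)
  define S where "S = {k\<in>{1..n}. b k \<le> t}"
  define m where "m = card S"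
  have S: "S = {1..m}"
  proof (cases "S = {}")
    case False
    have fin: "finite S" by (simp add: S_def)
    have max: "Max S \<in> S" using fin False by (rule Max_in)
    have "k \<in> S" if "k \<in> {1..Max S}" for k
    proof -
      have "b k \<le> b (Max S)"
        using b max that by (auto simp: S_def intro: mono_onD)
      thus ?thesis using max that by (auto simp: S_def)
    qed
    moreover have "k \<in> {1..Max S}" if "k \<in> S" for k
      using Max_ge[OF fin that] that by (auto simp: S_def)
    ultimately have "S = {1..Max S}" by blast
    then obtain j where j: "S = {1..j}" by blast
    hence "m = j" by (simp add: m_def)
    thus ?thesis using j by simp
  qed (simp add: m_def)
  have mem: "k \<in> {1..m} \<longleftrightarrow> k \<in> {1..n} \<and> b k \<le> t" for k
    unfolding S[symmetric] by (simp add: S_def)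
  have m: "{1..m} \<subseteq> {1..n}" using mem by blast
  have "(\<Sum>k=1..n. max 0 (t - b k)) = (\<Sum>k=1..m. max 0 (t - b k))"
  proof (rule sum.mono_neutral_right)
    show "\<forall>k\<in>{1..n} - {1..m}. max 0 (t - b k) = 0"
      using mem by (metis DiffD1 DiffD2 diff_le_0_iff_le linorder_le_cases max_absorb1)
  qed (use m in simp_all)
  also have "\<dots> = (\<Sum>k=1..m. t - b k)"
  proof (rule sum.cong[OF refl])
    fix k assume "k \<in> {1..m}"
    hence "b k \<le> t" using mem by blast
    thus "max 0 (t - b k) = t - b k" by simp
  qed
  also have "\<dots> \<le> (\<Sum>k=1..m. t - a k)"
  proof (cases "m = 0")
    case False
    hence "m \<in> {1..n}" using m by auto
    thus ?thesis using maj by (simp add: weak_supermaj_def sum_subtractf)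
  qed simp
  also have "\<dots> \<le> (\<Sum>k=1..m. max 0 (t - a k))"
    by (rule sum_mono) simp
  also have "\<dots> \<le> (\<Sum>k=1..n. max 0 (t - a k))"
    by (rule sum_mono2) (use m in auto)
  finally show ?thesis by (simp add: rho_fun_def eq)
qed

lemma gen_stieltjesI_density:
  fixes v :: "real \<Rightarrow> real"
  assumes nonneg: "\<And>t. v t \<ge> 0" and l: "l > 0"
    and int: "\<And>x. x > 0 \<Longrightarrow> set_integrable lborel {0<..} (\<lambda>t. v t / (x + t) ^ l)"
    and F: "\<And>x. x > 0 \<Longrightarrow> F x = (LINT t:{0<..}|lborel. v t / (x + t) ^ l)"
  shows "gen_stieltjes (real l) F"
  unfolding gen_stieltjes_def
proof (intro conjI exI allI impI)
  define w where "w = (\<lambda>t. indicator {0<..} t * v t)"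
  define M where "M = restrict_space (density lborel (\<lambda>t. ennreal (w t))) {0..}"
  have w: "w t \<ge> 0" for t using nonneg by (simp add: w_def)
  \<comment> \<open>Measurability of \<open>v\<close> on the half-line is implicit in the integrability at \<open>x = 1\<close>.\<close>
  have [measurable]: "w \<in> borel_measurable borel"
  proof -
    have "(\<lambda>t. indicator {0<..} t *\<^sub>R (v t / (1 + t) ^ l)) \<in> borel_measurable borel"
      using int[of 1] by (simp add: set_integrable_def borel_measurable_integrable)
    hence "(\<lambda>t. indicator {0<..} t *\<^sub>R (v t / (1 + t) ^ l) * (1 + t) ^ l) \<in> borel_measurable borel"
      by measurable
    also have "(\<lambda>t. indicator {0<..} t *\<^sub>R (v t / (1 + t) ^ l) * (1 + t) ^ l) = w"
      by (auto simp: w_def fun_eq_iff indicator_def)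
    finally show ?thesis .
  qed
  have kernel: "w t * (indicator {0..} t * (1 / (t + x) powr real l)) =
                indicator {0<..} t * (v t / (x + t) ^ l)" if "x > 0" for x t
    using that by (cases "t > 0") (auto simp: w_def powr_realpow add.commute)
  have [measurable]: "(\<lambda>t. indicator {0..} t * (1 / (t + x) powr real l)) \<in> borel_measurable borel"
    for x :: real by measurable
  show "sets M = sets (restrict_space borel {0..})"
    unfolding M_def by (intro sets_restrict_space_cong) simp
  show "real l > 0" using l by simp
  show "(0::real) \<le> 0" by simp
  fix x :: real assume x: "x > 0"
  have "integrable lborel (\<lambda>t. w t *\<^sub>R (indicator {0..} t * (1 / (t + x) powr real l)))"
    using int[OF x] unfolding real_scaleR_def kernel[OF x] by (simp add: set_integrable_def)
  hence "integrable (density lborel (\<lambda>t. ennreal (w t))) (\<lambda>t. indicator {0..} t *\<^sub>R (1 / (t + x) powr real l))"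
    by (subst integrable_density) (simp_all add: w)
  thus "integrable M (\<lambda>t. 1 / (t + x) powr real l)"
    unfolding M_def by (subst integrable_restrict_space) simp_all
  have "(LINT t|M. 1 / (t + x) powr real l) =
        (LINT t|density lborel (\<lambda>t. ennreal (w t)). indicator {0..} t * (1 / (t + x) powr real l))"
    unfolding M_def by (subst integral_restrict_space) simp_all
  also have "\<dots> = (LINT t|lborel. w t * (indicator {0..} t * (1 / (t + x) powr real l)))"
    by (subst integral_density) (simp_all add: w)
  also have "\<dots> = F x"
    unfolding kernel[OF x] F[OF x] by (simp add: set_lebesgue_integral_def)
  finally show "F x = (LINT t|M. 1 / (t + x) powr real l) + 0" by simp
qed

lemma set_integral_sum_diff:
  fixes X Y :: "'k \<Rightarrow> real \<Rightarrow> complex"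
  assumes X: "\<And>k. k \<in> K \<Longrightarrow> set_integrable lborel A (X k)"
    and Y: "\<And>k. k \<in> K \<Longrightarrow> set_integrable lborel A (Y k)"
  shows "set_integrable lborel A (\<lambda>t. \<Sum>k\<in>K. X k t - Y k t)"
    and "(LINT t:A|lborel. \<Sum>k\<in>K. X k t - Y k t) =
           (\<Sum>k\<in>K. (LINT t:A|lborel. X k t) - (LINT t:A|lborel. Y k t))"
  using assms unfolding set_integrable_def set_lebesgue_integral_def scaleR_sum_right scaleR_diff_right
  by (auto simp: Bochner_Integration.integral_sum)

lemma higher_deriv_log_W:
  assumes L: "log_branch f holomorphic_on {w. Re w > 0}" and z: "Re z > 0"
    and a: "\<forall>k\<in>{1..n}. 0 \<le> a k" and b: "\<forall>k\<in>{1..n}. 0 \<le> b k"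
  shows "(deriv ^^ p) (log_W f n a b) z =
           (\<Sum>k=1..n. (deriv ^^ p) (log_branch f) (z + of_real (a k)) -
                     (deriv ^^ p) (log_branch f) (z + of_real (b k)))"
proof -
  let ?H = "{w. Re w > 0}" and ?L = "log_branch f"
  have H: "open ?H" by (simp add: open_halfspace_Re_gt)
  have zH: "z \<in> ?H" using z by simp
  have hol: "(\<lambda>w. ?L (w + of_real c)) holomorphic_on ?H" if "c \<ge> 0" for c
    by (rule holomorphic_on_compose_gen[OF _ L, unfolded o_def])
       (use that in \<open>auto intro!: holomorphic_intros\<close>)
  have shift: "(deriv ^^ p) (\<lambda>w. ?L (w + of_real c)) z = (deriv ^^ p) ?L (z + of_real c)" if "c \<ge> 0" for c
    using higher_deriv_compose_linear'[OF L H H zH, of 1 "of_real c" p] that by simp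
  have "(deriv ^^ p) (log_W f n a b) z =
        (deriv ^^ p) (\<lambda>w. \<Sum>k=1..n. ?L (w + of_real (a k)) - ?L (w + of_real (b k))) z"
    by (simp only: log_W_def[abs_def])
  also have "\<dots> = (\<Sum>k=1..n. (deriv ^^ p) (\<lambda>w. ?L (w + of_real (a k)) - ?L (w + of_real (b k))) z)"
    by (rule higher_deriv_sum[OF _ H zH]) (use a b hol in \<open>intro holomorphic_on_diff; simp\<close>)
  also have "\<dots> = (\<Sum>k=1..n. (deriv ^^ p) ?L (z + of_real (a k)) - (deriv ^^ p) ?L (z + of_real (b k)))"
  proof (rule sum.cong[OF refl])
    fix k assume k: "k \<in> {1..n}"
    have ab: "a k \<ge> 0" "b k \<ge> 0" using a b k by auto
    show "(deriv ^^ p) (\<lambda>w. ?L (w + of_real (a k)) - ?L (w + of_real (b k))) z =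
          (deriv ^^ p) ?L (z + of_real (a k)) - (deriv ^^ p) ?L (z + of_real (b k))"
      by (subst higher_deriv_diff[OF hol[OF ab(1)] hol[OF ab(2)] H zH]) (simp only: shift ab)
  qed
  finally show ?thesis .
qed

theorem theorem1p1:
  fixes p n :: nat and f :: "complex \<Rightarrow> complex"
    and N :: enat and lam a b :: "nat \<Rightarrow> real"
  assumes f: "f \<in> class_E p"
    and lam_zeros: "lists_zeros f N (\<lambda>m. - of_real (lam m))"
    and lam_nonneg: "\<forall>m\<in>indices N. 0 \<le> lam m"
    and lam_mono: "mono_on (indices N) lam"
    and a_nonneg: "\<forall>k\<in>{1..n}. 0 \<le> a k" and a_mono: "mono_on {1..n} a"
    and b_nonneg: "\<forall>k\<in>{1..n}. 0 \<le> b k" and b_mono: "mono_on {1..n} b"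
  shows "(\<forall>s>0. (\<lambda>m. exp (- lam m * s)) summable_on indices N) \<and>
         (\<forall>t. (\<lambda>m. rho_fun n a b (t - lam m)) summable_on indices N) \<and>
         (\<forall>z. Re z > 0 \<longrightarrow>
            set_integrable lborel {0<..}
              (\<lambda>s. exp (- of_real s * z) * of_real (s ^ (p + 1) * h_fun N lam s * g_fun n a b s)) \<and>
            set_integrable lborel {0<..}
              (\<lambda>t. of_real (phi_fun N lam n a b t) / (z + of_real t) ^ (p + 2)) \<and>
            (-1) powi (int p - 1) * (deriv ^^ p) (log_W f n a b) z =
              (LINT s:{0<..}|lborel.
                 exp (- of_real s * z) * of_real (s ^ (p + 1) * h_fun N lam s * g_fun n a b s)) \<and>
            (LINT s:{0<..}|lborel.
                 exp (- of_real s * z) * of_real (s ^ (p + 1) * h_fun N lam s * g_fun n a b s)) =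
              Gamma (of_nat (p + 2)) *
              (LINT t:{0<..}|lborel. of_real (phi_fun N lam n a b t) / (z + of_real t) ^ (p + 2))) \<and>
         (weak_supermaj n b a \<longrightarrow>
            gen_stieltjes_complex (real (p + 2))
              (\<lambda>z. (-1) powi (int p - 1) * (deriv ^^ p) (log_W f n a b) z))"
proof -
  interpret summable_zeros p "indices N" lam
    by standard (use lam_nonneg class_E_zero_sums(1)[OF f lam_zeros] in auto)
  let ?I = "indices N"
  let ?C = "(-1) ^ p * fact p :: complex"
  let ?K = "\<lambda>z s. exp (- of_real s * z) * of_real (s ^ (p + 1) * h_fun N lam s * g_fun n a b s)"
  let ?S = "\<lambda>z t. of_real (phi_fun N lam n a b t) / (z + of_real t) ^ (p + 2)"
  let ?D = "\<lambda>z. (-1) powi (int p - 1) * (deriv ^^ p) (log_W f n a b) z"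
  define Z where "Z = (\<lambda>z. \<Sum>k=1..n. zero_sum (b k) z - zero_sum (a k) z)"
  have ab: "a k \<ge> 0" "b k \<ge> 0" if "k \<in> {1..n}" for k
    using that a_nonneg b_nonneg by auto
  have rho0: "rho_fun n a b t = 0" if "t \<le> 0" for t
    unfolding rho_fun_eq_ramps by (rule sum.neutral) (simp add: ramp_nonpos ab that)

  have L: "log_branch f holomorphic_on {w. Re w > 0}"
    using class_E_log_branch[OF f]
    by (auto simp: is_log_branch_def complex_nonpos_Reals_iff intro: holomorphic_on_subset)
  have D: "?D z = fact p * Z z" if z: "Re z > 0" for z
  proof -
    have diff: "(deriv ^^ p) (log_branch f) (z + of_real c) - (deriv ^^ p) (log_branch f) z = ?C * zero_sum c z"
      if "c \<ge> 0" for c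
      by (rule deriv_difference_eq_zero_sum[OF z that L class_E_zero_sums(2)[OF f lam_zeros]])
    have "(deriv ^^ p) (log_W f n a b) z =
            (\<Sum>k=1..n. ?C * zero_sum (a k) z - ?C * zero_sum (b k) z)"
      unfolding higher_deriv_log_W[OF L z a_nonneg b_nonneg]
      by (rule sum.cong[OF refl]) (simp add: diff[symmetric] ab)
    also have "\<dots> = - (?C * Z z)"
      by (simp add: Z_def sum_distrib_left sum_subtractf right_diff_distrib)
    finally have dW: "(deriv ^^ p) (log_W f n a b) z = - (?C * Z z)" .
    have sgn: "(-1) powi (int p - 1) = - ((-1) ^ p :: complex)"
      by (simp add: power_int_diff)
    have "?D z = ((-1) ^ p * (-1) ^ p) * (fact p * Z z)"
      unfolding sgn dW by (simp only: mult_ac minus_mult_minus)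
    also have "(-1) ^ p * (-1) ^ p = (1 :: complex)"
      by (simp flip: power_mult_distrib)
    finally show ?thesis by simp
  qed

  have laplace: "set_integrable lborel {0<..} (?K z) \<and> (LINT s:{0<..}|lborel. ?K z s) = fact p * Z z"
    if z: "Re z > 0" for z
  proof -
    define J where "J = (\<lambda>c s. exp (- of_real s * z) *
             of_real (s ^ p * ((1 - exp (- s * c)) / s) * (\<Sum>\<^sub>\<infinity>m\<in>?I. exp (- lam m * s))))"
    have J: "set_integrable lborel {0<..} (J c)" "(LINT s:{0<..}|lborel. J c s) = fact p * zero_sum c z"
      if "c \<ge> 0" for c
      using laplace_sum[OF z that] unfolding J_def by blast+
    have eq: "?K z s = (\<Sum>k=1..n. J (b k) s - J (a k) s)" if "s \<in> {0<..}" for s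
    proof -
      have "s ^ (p + 1) * h_fun N lam s * g_fun n a b s = s ^ p * h_fun N lam s * (s * g_fun n a b s)"
        by simp
      also have "\<dots> = (\<Sum>k=1..n. s ^ p * h_fun N lam s * ((1 - exp (- s * b k)) / s - (1 - exp (- s * a k)) / s))"
        using that by (simp only: g_fun_eq greaterThan_iff sum_distrib_left)
      also have "\<dots> = (\<Sum>k=1..n. s ^ p * ((1 - exp (- s * b k)) / s) * h_fun N lam s -
                               s ^ p * ((1 - exp (- s * a k)) / s) * h_fun N lam s)"
        by (intro sum.cong) (simp_all only: right_diff_distrib mult_ac)
      finally show ?thesis
        by (simp only: J_def h_fun_def of_real_sum of_real_diff sum_distrib_left right_diff_distrib)
    qed
    note sd = set_integral_sum_diff[of "{1..n}" "{0<..}" "\<lambda>k. J (b k)" "\<lambda>k. J (a k)"]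
    have "set_integrable lborel {0<..} (?K z) \<longleftrightarrow>
          set_integrable lborel {0<..} (\<lambda>s. \<Sum>k=1..n. J (b k) s - J (a k) s)"
      by (intro set_integrable_cong refl eq)
    moreover have "(LINT s:{0<..}|lborel. ?K z s) = (LINT s:{0<..}|lborel. \<Sum>k=1..n. J (b k) s - J (a k) s)"
      by (rule set_lebesgue_integral_cong) (use eq in auto)
    moreover have "(\<Sum>k=1..n. (LINT s:{0<..}|lborel. J (b k) s) - (LINT s:{0<..}|lborel. J (a k) s)) = fact p * Z z"
      unfolding Z_def sum_distrib_left right_diff_distrib by (rule sum.cong[OF refl]) (simp only: J ab)
    ultimately show ?thesis using sd J(1) ab by simp
  qed

  have stieltjes: "set_integrable lborel {0<..} (?S z) \<and>
      (LINT t:{0<..}|lborel. ?S z t) = 1 / of_nat (Suc p) * Z z" if z: "Re z > 0" for z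
  proof -
    define J where "J = (\<lambda>c t. of_real (\<Sum>\<^sub>\<infinity>m\<in>?I. ramp c (t - lam m)) / (z + of_real t) ^ (p + 2))"
    have J: "set_integrable lborel {0<..} (J c)"
      "(LINT t:{0<..}|lborel. J c t) = 1 / of_nat (Suc p) * zero_sum c z" if "c \<ge> 0" for c
      using stieltjes_sum[OF z that] unfolding J_def by blast+
    have eq: "?S z t = (\<Sum>k=1..n. J (b k) t - J (a k) t)" for t
    proof -
      have inf: "(\<Sum>\<^sub>\<infinity>m\<in>?I. ramp c (t - lam m)) = (\<Sum>m\<in>{m\<in>?I. lam m \<le> t}. ramp c (t - lam m))"
        if "c \<ge> 0" for c
        by (rule infsum_shift_finite(2)) (rule ramp_nonpos[OF that])
      have "phi_fun N lam n a b t = (\<Sum>m\<in>{m\<in>?I. lam m \<le> t}. rho_fun n a b (t - lam m))"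
        unfolding phi_fun_def by (rule infsum_shift_finite(2)) (rule rho0)
      also have "\<dots> = (\<Sum>k=1..n. \<Sum>m\<in>{m\<in>?I. lam m \<le> t}. ramp (b k) (t - lam m) - ramp (a k) (t - lam m))"
        unfolding rho_fun_eq_ramps by (rule sum.swap)
      also have "\<dots> = (\<Sum>k=1..n. (\<Sum>\<^sub>\<infinity>m\<in>?I. ramp (b k) (t - lam m)) - (\<Sum>\<^sub>\<infinity>m\<in>?I. ramp (a k) (t - lam m)))"
        by (rule sum.cong[OF refl]) (simp only: sum_subtractf inf ab)
      finally show ?thesis
        by (simp only: J_def of_real_sum of_real_diff sum_divide_distrib diff_divide_distrib)
    qed
    have "(\<Sum>k=1..n. (LINT t:{0<..}|lborel. J (b k) t) - (LINT t:{0<..}|lborel. J (a k) t)) =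
            1 / of_nat (Suc p) * Z z"
      unfolding Z_def sum_distrib_left right_diff_distrib by (rule sum.cong[OF refl]) (simp only: J ab)
    thus ?thesis
      using set_integral_sum_diff[of "{1..n}" "{0<..}" "\<lambda>k. J (b k)" "\<lambda>k. J (a k)"] J(1) ab
      unfolding eq by simp
  qed

  have Gam: "Gamma (of_nat (p + 2)) = (fact (Suc p) :: complex)"
    using Gamma_fact[of "Suc p", where ?'a = complex] by (simp add: add_ac)
  have fact_Z: "fact (Suc p) * (1 / of_nat (Suc p) * Z z) = fact p * Z z" for z
    by (simp add: fact_Suc[of p] del: of_nat_Suc)

  have gen: "gen_stieltjes_complex (real (p + 2)) ?D" if maj: "weak_supermaj n b a"
  proof -
    define v where "v = (\<lambda>t. fact (Suc p) * phi_fun N lam n a b t)"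
    have v: "v t \<ge> 0" for t
      unfolding v_def phi_fun_def using rho_fun_nonneg[OF maj b_mono]
      by (intro mult_nonneg_nonneg infsum_nonneg) auto
    have Sx: "(\<lambda>t. of_real (v t / (x + t) ^ (p + 2)) :: complex) = (\<lambda>t. fact (Suc p) * ?S (of_real x) t)" for x
      by (simp add: v_def fun_eq_iff)
    have int: "set_integrable lborel {0<..} (\<lambda>t. v t / (x + t) ^ (p + 2))" if "x > 0" for x
    proof -
      have "set_integrable lborel {0<..} (\<lambda>t. of_real (v t / (x + t) ^ (p + 2)) :: complex)"
        unfolding Sx using stieltjes[of "of_real x"] that by (intro set_integrable_mult_right) auto
      hence "integrable lborel (\<lambda>t. Re (indicator {0<..} t *\<^sub>R of_real (v t / (x + t) ^ (p + 2))))"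
        unfolding set_integrable_def by (rule integrable_Re)
      thus ?thesis by (simp only: set_integrable_def scaleR_complex.sel real_scaleR_def Re_complex_of_real)
    qed
    define G where "G = (\<lambda>x. LINT t:{0<..}|lborel. v t / (x + t) ^ (p + 2))"
    have "gen_stieltjes (real (p + 2)) G"
      by (rule gen_stieltjesI_density[OF v _ int]) (simp_all add: G_def)
    moreover have "?D (of_real x) = of_real (G x)" if "x > 0" for x
    proof -
      have x: "Re (of_real x) > 0" using that by simp
      have "of_real (G x) = (LINT t:{0<..}|lborel. of_real (v t / (x + t) ^ (p + 2)) :: complex)"
        unfolding G_def by (rule set_integral_complex_of_real[symmetric])
      also have "\<dots> = fact (Suc p) * (LINT t:{0<..}|lborel. ?S (of_real x) t)"
        unfolding Sx by (rule set_integral_mult_right)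
      also have "\<dots> = fact p * Z (of_real x)"
        using stieltjes[OF x] fact_Z by simp
      finally show ?thesis using D[OF x] by simp
    qed
    ultimately show ?thesis unfolding gen_stieltjes_complex_def by blast
  qed

  show ?thesis
  proof (intro conjI allI impI)
    show "(\<lambda>m. exp (- lam m * s)) summable_on ?I" if "s > 0" for s
      using that by (rule summable_exp)
    show "(\<lambda>m. rho_fun n a b (t - lam m)) summable_on ?I" for t
      by (rule infsum_shift_finite(1)) (rule rho0)
    fix z :: complex assume z: "Re z > 0"
    show "set_integrable lborel {0<..} (?K z)" using laplace[OF z] by blast
    show "set_integrable lborel {0<..} (?S z)" using stieltjes[OF z] by blast
    show "?D z = (LINT s:{0<..}|lborel. ?K z s)"
      using D[OF z] laplace[OF z] by (simp only:)
    show "(LINT s:{0<..}|lborel. ?K z s) = Gamma (of_nat (p + 2)) * (LINT t:{0<..}|lborel. ?S z t)"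
      using laplace[OF z] stieltjes[OF z] by (simp only: Gam fact_Z)
  qed (rule gen)
qed

end
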